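(* Let $\alpha_0$ be the probability measure on $[-1,1]$ with step density $$\alpha_0(d\sigma)=\frac{d\sigma}{c}\cdot\begin{cases}1,&|\sigma|>\tfrac13,\\ 2(59-18\sqrt{10}),&|\sigma|\le\tfrac13,\end{cases}$$ where $c=8(10-3\sqrt{10})$ is the normalizing constant, and let $g(\sigma)=\sigma$. Then $\frac{\partial^3}{\partial t^3}\log\alpha_0(e^{tg})<0$ for all $t>0$, and the smallest natural number $k$ with $\frac{\partial^k}{\partial t^k}\log\alpha_0(e^{tg})\big|_{t=0}<0$ is $k=6$. Consequently, let $W$ be a random variable with values in $(0,\infty)$ and $\mathbb{E}[W^2]<\infty$ such that either $\mathbb{E}[W^6]<\infty$, or there are $\tau\in(3,7]$, $C_W>c_W>0$ and $w_0>1$ with $c_Ww^{-(\tau-1)}\le\mathbb{P}(W>w)\le C_Ww^{-(\tau-1)}$ for all $w>w_0$. Then: - if $\mathbb{E}[W^6]<\infty$: $m^+(\theta,0)\asymp(\theta-\theta_c)^{1/4}$ as $\theta\searrow\theta_c$ and $m^+(\theta_c,h)\asymp h^{1/5}$ as $h\searrow0$; - if the power law holds with $\tau\in(3,7)$: $m^+(\theta,0)\asymp(\theta-\theta_c)^{1/(\tau-3)}$ as $\theta\searrow\theta_c$ and $m^+(\theta_c,h)\asymp h^{1/(\tau-2)}$ as $h\searrow0$; - if the power law holds with $\tau=7$: $m^+(\theta,0)\asymp\bigl(\frac{\theta-\theta_c}{\log(1/(\theta-\theta_c))}\bigr)^{1/4}$ as $\theta\searrow\theta_c$ and $m^+(\theta_c,h)\asymp\bigl(\frac{h}{\log(1/h)}\bigr)^{1/5}$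 as $h\searrow0$.
   Context: For a measure $\mu$ and function $f$, $\mu(f)=\int f\,d\mu$. $\mathbb{E}^{sb}[f(W)]=\mathbb{E}[Wf(W)]/\mathbb{E}[W]$. For $h\ge0$, $m\in\mathbb{R}$, $$\varphi_h(m)=\mathbb{E}^{sb}\left[\frac{\alpha_0(g\,e^{(Wm+h)g})}{\alpha_0(e^{(Wm+h)g})}\right],\qquad 1/\theta_c=\mathbb{E}^{sb}(W)\,\alpha_0(g^2).$$ For $h=0$ and $\theta>\theta_c$, $m^+(\theta,0)$ is the unique positive solution of $m/\theta=\varphi_0(m)$; for $h>0$ and $\theta>0$, $m^+(\theta,h)$ is the unique nonnegative solution of $m/\theta=\varphi_h(m)$. $f\asymp g$ means that $f/g$ is bounded away from $0$ and $\infty$ in the specified limit. *)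

theory Defs
  imports "HOL-Probability.Probability" "HOL-Library.Landau_Symbols"
begin

definition norm_const :: real where
  "norm_const = 8 * (10 - 3 * sqrt 10)"

definition step_density :: "real \<Rightarrow> real" where
  "step_density \<sigma> = (if \<bar>\<sigma>\<bar> > 1/3 then 1 else 2 * (59 - 18 * sqrt 10)) / norm_const"

text \<open>A measure on the Borel sets of the whole real line, concentrated on \<open>{-1..1}\<close>.\<close>

definition alpha0 :: "real measure" where
  "alpha0 = density lborel (\<lambda>\<sigma>. ennreal (step_density \<sigma> * indicator {-1..1} \<sigma>))"

definition g0 :: "real \<Rightarrow> real" where
  "g0 \<sigma> = \<sigma>"

definition log_mgf :: "real \<Rightarrow> real" where
  "log_mgf t = ln (\<integral>\<sigma>. exp (t * g0 \<sigma>) \<partial>alpha0)"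

definition sb_expectation :: "'a measure \<Rightarrow> ('a \<Rightarrow> real) \<Rightarrow> (real \<Rightarrow> real) \<Rightarrow> real" where
  "sb_expectation M W f = (\<integral>\<omega>. W \<omega> * f (W \<omega>) \<partial>M) / (\<integral>\<omega>. W \<omega> \<partial>M)"

definition phi :: "'a measure \<Rightarrow> ('a \<Rightarrow> real) \<Rightarrow> real \<Rightarrow> real \<Rightarrow> real" where
  "phi M W h m = sb_expectation M W (\<lambda>w.
     (\<integral>\<sigma>. g0 \<sigma> * exp ((w * m + h) * g0 \<sigma>) \<partial>alpha0) /
     (\<integral>\<sigma>. exp ((w * m + h) * g0 \<sigma>) \<partial>alpha0))"

definition theta_c :: "'a measure \<Rightarrow> ('a \<Rightarrow> real) \<Rightarrow> real" where
  "theta_c M W = 1 / (sb_expectation M W (\<lambda>w. w) * (\<integral>\<sigma>. (g0 \<sigma>)\<^sup>2 \<partial>alpha0))"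

text \<open>Only meaningful for \<open>h = 0\<close>, \<open>\<theta> > theta_c M W\<close> and for \<open>h > 0\<close>, \<open>\<theta> > 0\<close>. For
  \<open>h = 0\<close> the trivial solution \<open>m = 0\<close> has to be excluded.\<close>

definition m_plus :: "'a measure \<Rightarrow> ('a \<Rightarrow> real) \<Rightarrow> real \<Rightarrow> real \<Rightarrow> real" where
  "m_plus M W \<theta> h =
     (if h = 0 then (THE m. m > 0 \<and> m / \<theta> = phi M W 0 m)
      else (THE m. m \<ge> 0 \<and> m / \<theta> = phi M W h m))"

definition power_law :: "'a measure \<Rightarrow> ('a \<Rightarrow> real) \<Rightarrow> real \<Rightarrow> bool" where
  "power_law M W \<tau> \<longleftrightarrow>
     (\<exists>c C w0. 0 < c \<and> c < C \<and> 1 < w0 \<and>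
        (\<forall>w>w0. c * w powr (-(\<tau> - 1)) \<le> measure M {\<omega> \<in> space M. W \<omega> > w} \<and>
                measure M {\<omega> \<in> space M. W \<omega> > w} \<le> C * w powr (-(\<tau> - 1))))"

lemma prob_space_alpha0: "prob_space alpha0"
proof
  define a where "a = 2 * (59 - 18 * sqrt 10)"
  have s: "sqrt 10 < 3.2"
    by (rule real_less_lsqrt) (auto simp: power2_eq_square)
  have c: "norm_const > 0" and a: "a \<ge> 1"
    using s by (auto simp: norm_const_def a_def)
  have [measurable]: "step_density \<in> borel_measurable borel"
    unfolding step_density_def by measurable
  have eq: "ennreal (step_density \<sigma> * indicator {-1..1} \<sigma>) =
      ennreal (1 / norm_const) * indicator {-1..1} \<sigma> +
      ennreal ((a - 1) / norm_const) * indicator {-1/3..1/3} \<sigma>" for \<sigma> :: real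
    using a c by (auto simp: step_density_def indicator_def abs_if
        ennreal_plus[symmetric] field_simps simp del: ennreal_plus split: if_splits)
      (simp_all add: a_def)
  have "emeasure alpha0 (space alpha0) =
      (\<integral>\<^sup>+\<sigma>. ennreal (1 / norm_const) * indicator {-1..1::real} \<sigma> +
      ennreal ((a - 1) / norm_const) * indicator {-1/3..1/3} \<sigma> \<partial>lborel)"
    unfolding alpha0_def by (subst emeasure_density) (auto simp: eq)
  also have "\<dots> = ennreal (1 / norm_const) * ennreal 2 + ennreal ((a - 1) / norm_const) * ennreal (2/3)"
    by (subst nn_integral_add) (auto simp: nn_integral_cmult_indicator)
  also have "\<dots> = ennreal (1 / norm_const * 2 + (a - 1) / norm_const * (2/3))"
    using a c by (simp only: ennreal_mult[symmetric] ennreal_plus[symmetric] divide_nonneg_pos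
        zero_le_numeral zero_le_one diff_ge_0_iff_ge mult_nonneg_nonneg divide_nonneg_nonneg)
  also have "1 / norm_const * 2 + (a - 1) / norm_const * (2/3) = 1"
    using c by (simp add: field_simps) (simp add: a_def norm_const_def)
  finally show "emeasure alpha0 (space alpha0) = 1" by simp
qed

end

theory Submission
  imports Defs "HOL-Real_Asymp.Real_Asymp"
begin

text \<open>With \<open>u = 2t/3\<close> one has
  \<open>\<alpha>\<^sub>0(e\<^bsup>tg\<^esup>) = (2/(ct)) sinh(t/3) (d + 2 cosh u)\<close> for \<open>d = 118 - 36\<surd>10\<close>, so the third cumulant is explicit.
  Bounding \<open>u\<close> from above by a Pade approximant in \<open>sinh u\<close> and \<open>cosh u\<close> turns its negativity into
  a polynomial inequality all of whose coefficients have the right sign, the lowest ones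
  vanishing because \<open>d\<close> is chosen to annihilate the fourth cumulant.

  Write the derivative of the log moment generating function as \<open>vt - \<rho>(t)\<close>. It is concave and
  its first nonlinear Taylor coefficient is the sixth cumulant, hence \<open>\<rho>(t)/t\<close> is increasing and
  \<open>\<rho>(t) \<asymp> min(t\<^sup>5, t)\<close>. The linear terms cancel at \<open>\<theta>\<^sub>c\<close>: with
  \<open>K(m) = E[min(W\<^sup>6 m\<^sup>4, W\<^sup>2)]\<close> the fixed point equations reduce to
  \<open>K(m) \<asymp> \<theta> - \<theta>\<^sub>c\<close> for \<open>h = 0\<close> and to \<open>m K(m) \<asymp> h\<close> for \<open>\<theta> = \<theta>\<^sub>c\<close>. A layer-cake computation
  gives \<open>K(m) \<asymp> m\<^sup>4\<close>, \<open>m\<^bsup>\<tau>-3\<^esup>\<close> or \<open>m\<^sup>4 log(1/m)\<close> in the three cases.\<close>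

section \<open>Cumulants of the single-spin measure\<close>

text \<open>The equation E[sigma^4] = 3 E[sigma^2]^2 says that \<open>bump\<close> is a root b of
  b^2 - 234 b + 729 = 0. The conjugate root 117 + 36 sqrt 10 also annihilates the fourth cumulant,
  but makes the sixth positive. The step sits at 1/3 because sinh(3x)/sinh(x) = 1 + 2 cosh(2x),
  which is what makes the transform factor.

  Negativity of the third cumulant is used on the whole half-line. The sixth moment of W may be
  infinite, and W m need not be small when m is, so a Taylor expansion at 0 cannot be integrated
  against the law of W. Monotonicity of rho(t)/t carries the local order t^5 to a global two-sided
  bound, and W min((W m)^5, W m) is integrable as soon as E[W^2] is finite. The same monotonicity
  gives uniqueness of the positive solution for h = 0; without existence and uniqueness the definite
  description in \<open>m_plus\<close> says nothing.\<close>

definition bump :: real where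
  "bump = 117 - 36 * sqrt 10"

lemma sqrt10_bounds: "3.1622 < sqrt (10::real)" "sqrt (10::real) < 3.1623"
  by (rule real_less_rsqrt real_less_lsqrt; simp add: power2_eq_square)+

lemma bump_pos: "bump > 0"
  using sqrt10_bounds by (simp add: bump_def)

lemma norm_const_pos: "norm_const > 0"
  using sqrt10_bounds by (simp add: norm_const_def)

lemma inverse_norm_const: "1 / norm_const = (10 + 3 * sqrt 10) / 80"
  using norm_const_pos by (simp add: field_simps norm_const_def)

text \<open>\<open>alpha0\<close> is a mixture of two uniform laws, so its integrals reduce to two
  interval integrals. Before normalisation, \<open>bump\<close> is the excess of the middle height
  over the outer one.\<close>

lemma step_density_split:
  "step_density \<sigma> * indicator {-1..1} \<sigma> =
     (indicator {-1..1} \<sigma> + bump * indicator {-1/3..1/3} \<sigma>) / norm_const"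
  by (auto simp: step_density_def bump_def indicator_def abs_if split: if_splits)

section \<open>Integration against the step measure\<close>

lemma lborel_integral_Icc:
  fixes f :: "real \<Rightarrow> real"
  assumes "continuous_on UNIV f"
  shows "integrable lborel (\<lambda>x. indicator {a..b} x * f x)"
    and "(\<integral>x. indicator {a..b} x * f x \<partial>lborel) = integral {a..b} f"
proof -
  have "set_integrable lborel {a..b} f"
    by (rule borel_integrable_atLeastAtMost'[OF continuous_on_subset[OF assms]]) auto
  from this set_borel_integral_eq_integral(2)[OF this]
  show "integrable lborel (\<lambda>x. indicator {a..b} x * f x)"
    and "(\<integral>x. indicator {a..b} x * f x \<partial>lborel) = integral {a..b} f"
    by (simp_all add: set_integrable_def set_lebesgue_integral_def)
qed

text \<open>Passing to Henstock-Kurzweil integrals over compact intervals gives access to the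
  fundamental theorem of calculus and to Leibniz' rule.\<close>

lemma alpha0_integral:
  assumes f: "continuous_on UNIV f"
  shows "(\<integral>\<sigma>. f \<sigma> \<partial>alpha0) = (integral {-1..1} f + bump * integral {-1/3..1/3} f) / norm_const"
proof -
  note [measurable] = borel_measurable_continuous_onI[OF f]
  have [measurable]: "step_density \<in> borel_measurable borel"
    unfolding step_density_def by measurable
  have "step_density \<sigma> \<ge> 0" for \<sigma>
    using norm_const_pos sqrt10_bounds by (auto simp: step_density_def)
  then have "(\<integral>\<sigma>. f \<sigma> \<partial>alpha0) = (\<integral>\<sigma>. (step_density \<sigma> * indicator {-1..1} \<sigma>) * f \<sigma> \<partial>lborel)"
    unfolding alpha0_def by (subst integral_density) auto
  also have "\<dots> = (\<integral>\<sigma>. (1 / norm_const) * (indicator {-1..1} \<sigma> * f \<sigma>) +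
      (bump / norm_const) * (indicator {-1/3..1/3} \<sigma> * f \<sigma>) \<partial>lborel)"
    unfolding step_density_split by (simp add: algebra_simps add_divide_distrib)
  also have "\<dots> = (1 / norm_const) * integral {-1..1} f + (bump / norm_const) * integral {-1/3..1/3} f"
    by (subst Bochner_Integration.integral_add)
       (intro integrable_mult_right lborel_integral_Icc(1)[OF f],
        intro integrable_mult_right lborel_integral_Icc(1)[OF f],
        simp only: integral_mult_right_zero lborel_integral_Icc(2)[OF f])
  finally show ?thesis by (simp add: add_divide_distrib)
qed

lemma alpha0_integral_FTC:
  assumes f: "continuous_on UNIV f" and F: "\<And>x. (F has_real_derivative f x) (at x)"
  shows "(\<integral>\<sigma>. f \<sigma> \<partial>alpha0) = (F 1 - F (-1) + bump * (F (1/3) - F (-1/3))) / norm_const"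
proof -
  have "integral {a..b} f = F b - F a" if "a \<le> b" for a b
    using fundamental_theorem_of_calculus[OF that, of F f] F
    by (auto simp: has_real_derivative_iff_has_vector_derivative[symmetric]
        intro!: integral_unique intro: has_field_derivative_at_within)
  then show ?thesis by (simp add: alpha0_integral[OF f])
qed

lemma alpha0_integral_mono:
  fixes f g :: "real \<Rightarrow> real"
  assumes "continuous_on UNIV f" "continuous_on UNIV g" "\<And>x. \<bar>x\<bar> \<le> 1 \<Longrightarrow> f x \<le> g x"
  shows "(\<integral>\<sigma>. f \<sigma> \<partial>alpha0) \<le> (\<integral>\<sigma>. g \<sigma> \<partial>alpha0)"
proof -
  have "integral {a..b} f \<le> integral {a..b} g" if "-1 \<le> a" "b \<le> 1" for a b
  proof (rule Henstock_Kurzweil_Integration.integral_le)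
    show "f integrable_on {a..b}" "g integrable_on {a..b}"
      using assms(1,2) by (auto intro: integrable_continuous_real continuous_on_subset)
  qed (use that assms(3) in auto)
  then show ?thesis
    using bump_pos norm_const_pos
    by (auto simp: alpha0_integral assms(1,2) intro!: divide_right_mono add_mono mult_left_mono)
qed

section \<open>Moments under exponential tilting\<close>

definition mom :: "nat \<Rightarrow> real \<Rightarrow> real" where
  "mom k t = (\<integral>\<sigma>. \<sigma> ^ k * exp (t * \<sigma>) \<partial>alpha0)"

lemma mom_deriv: "(mom k has_real_derivative mom (Suc k) t) (at t)"
proof -
  have c: "continuous_on UNIV (\<lambda>\<sigma>::real. \<sigma> ^ k * exp (t * \<sigma>))" for t k
    by (intro continuous_intros)
  have d: "((\<lambda>t. integral {a..b} (\<lambda>\<sigma>. \<sigma> ^ k * exp (t * \<sigma>))) has_real_derivative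
      integral {a..b} (\<lambda>\<sigma>. \<sigma> ^ Suc k * exp (t * \<sigma>))) (at t)" for a b :: real
    unfolding cbox_interval[symmetric]
    by (rule leibniz_rule_field_derivative)
       (auto intro!: derivative_eq_intros integrable_continuous_real continuous_intros
         simp: case_prod_unfold)
  show ?thesis
    unfolding mom_def alpha0_integral[OF c]
    by (intro DERIV_cdivide DERIV_add DERIV_cmult d)
qed

lemma mom0_pos: "mom 0 t > 0"
proof -
  interpret prob_space alpha0 by (rule prob_space_alpha0)
  have "(\<integral>\<sigma>. exp (-\<bar>t\<bar>) \<partial>alpha0) \<le> mom 0 t"
    unfolding mom_def
  proof (rule alpha0_integral_mono)
    show "exp (-\<bar>t\<bar>) \<le> x ^ 0 * exp (t * x)" if "\<bar>x\<bar> \<le> 1" for x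
      using mult_left_mono[OF that, of "\<bar>t\<bar>"] abs_ge_minus_self[of "t * x"]
      by (simp add: abs_mult)
  qed (auto intro!: continuous_intros)
  moreover have "(\<integral>\<sigma>. exp (-\<bar>t\<bar>) \<partial>alpha0) = exp (-\<bar>t\<bar>)"
    using prob_space by (simp add: lebesgue_integral_const)
  ultimately show ?thesis
    using exp_gt_zero[of "-\<bar>t\<bar>"] by linarith
qed

lemma mom_abs_le: "\<bar>mom k t\<bar> \<le> mom 0 t"
proof -
  have b: "\<bar>x ^ k\<bar> \<le> 1" if "\<bar>x\<bar> \<le> 1" for x :: real
    using that by (simp add: power_abs power_le_one)
  have "mom k t \<le> mom 0 t"
    unfolding mom_def
  proof (rule alpha0_integral_mono)
    show "x ^ k * exp (t * x) \<le> x ^ 0 * exp (t * x)" if "\<bar>x\<bar> \<le> 1" for x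
      using b[OF that] by simp
  qed (auto intro!: continuous_intros)
  moreover have "(\<integral>\<sigma>. - (\<sigma> ^ k * exp (t * \<sigma>)) \<partial>alpha0) \<le> mom 0 t"
    unfolding mom_def
  proof (rule alpha0_integral_mono)
    show "- (x ^ k * exp (t * x)) \<le> x ^ 0 * exp (t * x)" if "\<bar>x\<bar> \<le> 1" for x
      using b[OF that] mult_right_mono[of "- (x^k)" 1 "exp (t * x)"] by simp
  qed (auto intro!: continuous_intros)
  ultimately show ?thesis by (simp add: mom_def)
qed

text \<open>Moments of the measure with density proportional to e^(t sigma) with respect to
  \<open>alpha0\<close>; \<open>cumulant 1 t\<close> is its mean and \<open>cumulant 2 t\<close> its
  variance.\<close>

definition rmom :: "nat \<Rightarrow> real \<Rightarrow> real" where
  "rmom k t = mom k t / mom 0 t"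

lemma rmom_abs_le: "\<bar>rmom k t\<bar> \<le> 1"
  using mom_abs_le[of k t] mom0_pos[of t] by (simp add: rmom_def)

text \<open>Tilted moments differentiate to polynomials in tilted moments. Differentiating a
  cumulant written in them therefore stays polynomial.\<close>

lemma rmom_deriv [derivative_intros]:
  assumes "(f has_real_derivative f') (at x within S)"
  shows "((\<lambda>x. rmom k (f x)) has_real_derivative
     ((rmom (Suc k) (f x) - rmom k (f x) * rmom 1 (f x)) * f')) (at x within S)"
proof -
  have "(rmom k has_real_derivative rmom (Suc k) t - rmom k t * rmom 1 t) (at t)" for t
    unfolding rmom_def[abs_def]
    by (rule derivative_eq_intros mom_deriv refl)+
       (use mom0_pos[of t] in \<open>auto simp: field_simps power2_eq_square\<close>)
  from DERIV_chain2[OF this assms] show ?thesis .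
qed

lemma rmom_continuous [continuous_intros]:
  "continuous_on S f \<Longrightarrow> continuous_on S (\<lambda>x. rmom k (f x))"
proof -
  have "isCont (rmom k) t" for t
    by (rule DERIV_isCont) (rule rmom_deriv[OF DERIV_ident, simplified])
  then have "continuous_on UNIV (rmom k)"
    by (simp add: continuous_at_imp_continuous_on)
  then show "continuous_on S f \<Longrightarrow> continuous_on S (\<lambda>x. rmom k (f x))"
    by (rule continuous_on_compose2) auto
qed

text \<open>The index 0 stands for the log moment generating function; only indices up to 6 are meaningful.\<close>

definition cumulant :: "nat \<Rightarrow> real \<Rightarrow> real" where
  "cumulant n t = (let r = (\<lambda>k. rmom k t) in
    if n = 1 then r 1
    else if n = 2 then r 2 - r 1 ^ 2
    else if n = 3 then r 3 - 3 * r 1 * r 2 + 2 * r 1 ^ 3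
    else if n = 4 then r 4 - 4 * r 3 * r 1 - 3 * r 2 ^ 2 + 12 * r 2 * r 1 ^ 2 - 6 * r 1 ^ 4
    else if n = 5 then r 5 - 5 * r 4 * r 1 - 10 * r 3 * r 2 + 20 * r 3 * r 1 ^ 2
      + 30 * r 2 ^ 2 * r 1 - 60 * r 2 * r 1 ^ 3 + 24 * r 1 ^ 5
    else if n = 6 then r 6 - 6 * r 5 * r 1 - 15 * r 4 * r 2 + 30 * r 4 * r 1 ^ 2 - 10 * r 3 ^ 2
      + 120 * r 3 * r 2 * r 1 - 120 * r 3 * r 1 ^ 3 + 30 * r 2 ^ 3 - 270 * r 2 ^ 2 * r 1 ^ 2
      + 360 * r 2 * r 1 ^ 4 - 120 * r 1 ^ 6
    else ln (mom 0 t))"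

lemma log_mgf_eq: "log_mgf = cumulant 0"
  by (auto simp: log_mgf_def cumulant_def mom_def g0_def)

text \<open>The case n = 0 is the logarithmic derivative of \<open>mom 0\<close>; the others are
  polynomial identities in the tilted moments. The range stops at 6 because
  \<open>cumulant 7\<close> is, by the default branch, the log moment generating function
  again.\<close>

lemma cumulant_deriv:
  assumes "n < 6"
  shows "(cumulant n has_real_derivative cumulant (Suc n) t) (at t)"
proof -
  have "n \<in> {0, 1, 2, 3, 4, 5}" using assms by auto
  moreover have "(cumulant 0 has_real_derivative cumulant (Suc 0) t) (at t)"
    unfolding cumulant_def[abs_def] Let_def
    by (auto intro!: derivative_eq_intros mom_deriv simp: mom0_pos rmom_def)
  moreover have "(cumulant 1 has_real_derivative cumulant (Suc 1) t) (at t)"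
    unfolding cumulant_def[abs_def] Let_def
    by (simp, (rule derivative_eq_intros refl)+) (simp add: eval_nat_numeral)
  moreover have "(cumulant 2 has_real_derivative cumulant (Suc 2) t) (at t)"
    unfolding cumulant_def[abs_def] Let_def
    by (simp, (rule derivative_eq_intros refl)+) (simp add: eval_nat_numeral, algebra)
  moreover have "(cumulant 3 has_real_derivative cumulant (Suc 3) t) (at t)"
    unfolding cumulant_def[abs_def] Let_def
    by (simp, (rule derivative_eq_intros refl)+) (simp add: eval_nat_numeral, algebra)
  moreover have "(cumulant 4 has_real_derivative cumulant (Suc 4) t) (at t)"
    unfolding cumulant_def[abs_def] Let_def
    by (simp, (rule derivative_eq_intros refl)+) (simp add: eval_nat_numeral, algebra)
  moreover have "(cumulant 5 has_real_derivative cumulant (Suc 5) t) (at t)"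
    unfolding cumulant_def[abs_def] Let_def
    by (simp, (rule derivative_eq_intros refl)+) (simp add: eval_nat_numeral, algebra)
  ultimately show ?thesis by auto
qed

lemma log_mgf_derivs:
  assumes "n \<le> 6"
  shows "(deriv ^^ n) log_mgf = cumulant n"
  using assms
proof (induction n)
  case (Suc n)
  then have "deriv (cumulant n) = cumulant (Suc n)"
    using cumulant_deriv[of n] by (auto intro!: ext DERIV_imp_deriv)
  with Suc show ?case by simp
qed (simp add: log_mgf_eq)

section \<open>Values at zero\<close>

lemma mom_at_0:
  "mom k 0 = (1 + bump / 3 ^ Suc k) * (1 - (-1) ^ Suc k) / (norm_const * Suc k)"
proof -
  have alg: "(1 ^ m / n - e / n + b * (1 / p / n - e * (1 / p) / n)) / c =
      (1 + b / p) * (1 - e) / (c * n)" if "n > 0" "p > 0" "c > 0" for m and n e b p c :: real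
    using that by (simp add: field_simps)
  have "mom k 0 = (\<integral>\<sigma>. \<sigma> ^ k \<partial>alpha0)" by (simp add: mom_def)
  also have "\<dots> = (1 ^ Suc k / Suc k - (-1) ^ Suc k / Suc k +
      bump * ((1/3) ^ Suc k / Suc k - (-1/3) ^ Suc k / Suc k)) / norm_const"
  proof (rule alpha0_integral_FTC)
    fix x :: real
    show "((\<lambda>x. x ^ Suc k / Suc k) has_real_derivative x ^ k) (at x)"
      using DERIV_cdivide[OF DERIV_pow[of "Suc k" x UNIV], of "real (Suc k)"] by simp
  qed (auto intro!: continuous_intros)
  also have "(-1/3::real) ^ Suc k = (-1) ^ Suc k * (1/3) ^ Suc k"
    by (simp only: power_mult_distrib[symmetric]) simp
  also have "(1/3::real) ^ Suc k = 1 / 3 ^ Suc k"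
    by (rule power_one_over)
  also have "(1 ^ Suc k / Suc k - (-1) ^ Suc k / Suc k +
      bump * (1 / 3 ^ Suc k / Suc k - (-1) ^ Suc k * (1 / 3 ^ Suc k) / Suc k)) / norm_const =
      (1 + bump / 3 ^ Suc k) * (1 - (-1) ^ Suc k) / (norm_const * Suc k)"
    by (rule alg) (use norm_const_pos in auto)
  finally show ?thesis .
qed

lemma rmom_odd_at_0: "odd k \<Longrightarrow> rmom k 0 = 0"
  by (simp add: rmom_def mom_at_0)

lemma rmom_even_at_0:
  "rmom 2 0 = 1/9 + sqrt 10 / 45"
  "rmom 4 0 = 7/135 + 2/135 * sqrt 10"
  "rmom 6 0 = 61/1701 + 13/1215 * sqrt 10"
proof -
  have r: "sqrt 10 * sqrt 10 = (10::real)" "sqrt 10 * (sqrt 10 * x) = 10 * x" for x :: real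
    by (simp_all flip: mult.assoc)
  \<comment> \<open>The rationalised form of 1 / \<open>norm_const\<close> keeps all values of the
    shape p + q sqrt 10 without a radical in a denominator.\<close>
  have m: "mom k 0 = (1 + bump / 3 ^ Suc k) * ((1 - (-1) ^ Suc k) / Suc k) * ((10 + 3 * sqrt 10) / 80)" for k
    unfolding mom_at_0 inverse_norm_const[symmetric] by simp
  have "mom 0 0 = 1" "mom 2 0 = 1/9 + sqrt 10 / 45"
    "mom 4 0 = 7/135 + 2/135 * sqrt 10" "mom 6 0 = 61/1701 + 13/1215 * sqrt 10"
    unfolding m by (simp_all add: bump_def algebra_simps add_divide_distrib diff_divide_distrib r)
  then show "rmom 2 0 = 1/9 + sqrt 10 / 45"
    "rmom 4 0 = 7/135 + 2/135 * sqrt 10" "rmom 6 0 = 61/1701 + 13/1215 * sqrt 10"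
    by (simp_all add: rmom_def)
qed

text \<open>Odd cumulants vanish by symmetry. With r k = \<open>rmom k 0\<close>, the relation r 4 =
  3 (r 2)^2 annihilates the fourth and turns the sixth into r 6 - 15 (r 2)^3.\<close>

lemma cumulants_at_0:
  "cumulant 0 0 = 0" "cumulant 1 0 = 0" "cumulant 2 0 > 0" "cumulant 3 0 = 0"
  "cumulant 4 0 = 0" "cumulant 5 0 = 0" "cumulant 6 0 < 0"
proof -
  have z: "rmom (Suc 0) 0 = 0" "rmom 3 0 = 0" "rmom 5 0 = 0" by (simp_all add: rmom_odd_at_0)
  have r: "sqrt 10 * sqrt 10 = (10::real)" "sqrt 10 * (sqrt 10 * x) = 10 * x" for x :: real
    by (simp_all flip: mult.assoc)
  have m: "mom 0 0 = 1" using prob_space.prob_space[OF prob_space_alpha0] by (simp add: mom_def)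
  show "cumulant 0 0 = 0" "cumulant 1 0 = 0" "cumulant 2 0 > 0" "cumulant 3 0 = 0"
    "cumulant 4 0 = 0" "cumulant 5 0 = 0"
    using sqrt10_bounds
    by (simp_all add: r cumulant_def z m rmom_even_at_0 power2_eq_square field_simps)
  have "cumulant 6 0 = -16/1701 - 4/1215 * sqrt 10"
    by (simp add: r cumulant_def z rmom_even_at_0 power2_eq_square power3_eq_cube field_simps)
  then show "cumulant 6 0 < 0" using sqrt10_bounds by simp
qed

section \<open>Negativity of the third cumulant\<close>

text \<open>The constant d in the factor d + 2 cosh u: \<open>bump\<close> plus the 1 from sinh t =
  sinh(t/3) (1 + 2 cosh(2t/3)).\<close>

definition coshw :: real where
  "coshw = bump + 1"

text \<open>The sum \<open>coshw + 2\<close> is d + 2 cosh u at u = 0. Its quadratic equation is the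
  vanishing of the fourth cumulant, rewritten from \<open>bump\<close> to
  \<open>bump + 3\<close>.\<close>

lemma coshw_props:
  "coshw > 0" "coshw + 2 > 6.157" "coshw + 2 < 6.17"
  "(coshw + 2)\<^sup>2 = 240 * (coshw + 2) - 1440"
  using sqrt10_bounds by (auto simp: coshw_def bump_def power2_eq_square algebra_simps)

lemma mom0_eq:
  assumes "t > 0"
  shows "mom 0 t = 2 / norm_const * sinh (t / 3) * (coshw + 2 * cosh (2 * t / 3)) / t"
proof -
  have "mom 0 t = (\<integral>\<sigma>. exp (t * \<sigma>) \<partial>alpha0)"
    by (simp add: mom_def)
  also have "\<dots> = (exp (t * 1) / t - exp (t * (-1)) / t +
      bump * (exp (t * (1/3)) / t - exp (t * (-1/3)) / t)) / norm_const"
    by (rule alpha0_integral_FTC)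
       (use assms in \<open>auto intro!: continuous_intros derivative_eq_intros\<close>)
  also have "\<dots> = 2 / norm_const * (sinh t + bump * sinh (t / 3)) / t"
    using assms norm_const_pos by (simp add: sinh_def field_simps)
  also have "sinh t = sinh (t / 3 + 2 * (t / 3))" by simp
  also have "\<dots> = sinh (t / 3) * (1 + 2 * cosh (2 * t / 3))"
  proof -
    have c: "cosh (2 * (t / 3)) = 2 * (cosh (t / 3))\<^sup>2 - 1" by (rule cosh_double_cosh)
    have "2 * t / 3 = 2 * (t / 3)" by simp
    then show ?thesis
      by (simp only: sinh_add sinh_double c power2_eq_square) (simp add: algebra_simps)
  qed
  finally show ?thesis
    by (simp add: coshw_def algebra_simps)
qed

text \<open>Logarithm of the factorisation above and its derivatives, with the \<open>sinh\<close> factor rewritten by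
  \<open>coth(t/3) = sinh(2t/3)/(cosh(2t/3) - 1)\<close>.\<close>

definition cumulant_closed :: "nat \<Rightarrow> real \<Rightarrow> real" where
  "cumulant_closed n t = (let s = sinh (2 * t / 3); x = cosh (2 * t / 3); d = coshw in
    if n = 1 then s / (x - 1) / 3 + 4/3 * s / (d + 2 * x) - 1 / t
    else if n = 2 then 1 / t\<^sup>2 - 2/9 / (x - 1) + 8/9 * (d * x + 2) / (d + 2 * x)\<^sup>2
    else if n = 3 then 4/27 * s / (x - 1)\<^sup>2 + 16/27 * s * (d\<^sup>2 - 8 - 2 * d * x) / (d + 2 * x) ^ 3 - 2 / t ^ 3
    else ln (2 / norm_const) + ln (sinh (t / 3)) + ln (d + 2 * x) - ln t)"

lemma cosh_gt_1: "(x::real) \<noteq> 0 \<Longrightarrow> cosh x > 1"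
  using cosh_real_ge_1[of x] cosh_real_one_iff[of x] by linarith

text \<open>Even powers of \<open>s\<close> are eliminated by s^2 = x^2 - 1, so a factor
  \<open>s\<close> survives only in the odd orders.\<close>

lemma cumulant_closed_deriv:
  assumes "n < 3" "t > 0"
  shows "(cumulant_closed n has_real_derivative cumulant_closed (Suc n) t) (at t)"
proof -
  define x where "x = cosh (2 * t / 3)"
  define s where "s = sinh (2 * t / 3)"
  define d where "d = coshw"
  have x: "x > 1" "x \<noteq> 1" "x - 1 \<noteq> 0" and s: "s > 0" and ss: "s * s = x * x - 1"
    using assms cosh_gt_1[of "2 * t / 3"] cosh_square_eq[of "2 * t / 3"]
    by (auto simp: x_def s_def power2_eq_square)
  have d: "d > 0" and p: "d + 2 * x > 0" "d + 2 * x \<noteq> 0"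
    using coshw_props x by (auto simp: d_def)
  have n: "n \<in> {0, 1, 2}" using assms by auto
  have S': "((\<lambda>t. sinh (2 * t / 3)) has_real_derivative 2/3 * x) (at t)"
    and X': "((\<lambda>t. cosh (2 * t / 3)) has_real_derivative 2/3 * s) (at t)"
    by ((rule derivative_eq_intros refl)+, simp add: s_def x_def)+
  have E': "((\<lambda>t. d + 2 * cosh (2 * t / 3)) has_real_derivative 4/3 * s) (at t)"
    using DERIV_add[OF DERIV_const DERIV_cmult[OF X', of 2]] by simp
  have X1': "((\<lambda>t. cosh (2 * t / 3) - 1) has_real_derivative 2/3 * s) (at t)"
    using DERIV_diff[OF X' DERIV_const] by simp
  have nz: "cosh (2 * t / 3) - 1 \<noteq> 0" "d + 2 * cosh (2 * t / 3) \<noteq> 0"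
    using x p by (auto simp: x_def)
  have coth: "cosh (t / 3) / sinh (t / 3) = s / (x - 1)"
  proof -
    have "sinh (t / 3) > 0" using assms by simp
    moreover have "s = 2 * sinh (t/3) * cosh (t/3)" "x - 1 = 2 * sinh (t/3) * sinh (t/3)"
      using sinh_double[of "t/3"] cosh_double[of "t/3"] cosh_square_eq[of "t/3"]
      by (simp_all add: s_def x_def power2_eq_square)
    ultimately show ?thesis by simp
  qed
  have "(cumulant_closed 0 has_real_derivative cosh (t/3) / sinh (t/3) / 3 + 4/3 * s / (d + 2 * x) - 1 / t) (at t)"
  proof -
    have "cumulant_closed 0 = (\<lambda>t. ln (2 / norm_const) + ln (sinh (t / 3)) + ln (d + 2 * cosh (2 * t / 3)) - ln t)"
      by (auto simp: cumulant_closed_def d_def)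
    moreover have "((\<lambda>t. ln (2 / norm_const) + ln (sinh (t / 3)) + ln (d + 2 * cosh (2 * t / 3)) - ln t) has_real_derivative
        0 + cosh (t/3) / sinh (t/3) / 3 + 4/3 * s / (d + 2 * x) - 1 / t) (at t)"
    proof -
      have ln': "((\<lambda>t. ln (g t)) has_real_derivative g' / g t) (at t)"
        if "g t > 0" "(g has_real_derivative g') (at t)" for g :: "real \<Rightarrow> real" and g'
        using DERIV_chain2[OF DERIV_ln_divide[OF that(1)] that(2)] by simp
      have h': "((\<lambda>t. sinh (t / 3)) has_real_derivative cosh (t/3) / 3) (at t)"
        by ((rule derivative_eq_intros refl)+, simp)+
      have "sinh (t / 3) > 0" "d + 2 * cosh (2 * t / 3) > 0"
        using assms p(1) by (auto simp: x_def)
      note l = ln'[OF this(1) h'] ln'[OF this(2) E']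
      from DERIV_diff[OF DERIV_add[OF DERIV_add[OF DERIV_const l(1)] l(2)] DERIV_ln_divide[OF assms(2)]]
      show ?thesis by (simp add: x_def mult.commute)
    qed
    ultimately show ?thesis by simp
  qed
  then have 0: "(cumulant_closed 0 has_real_derivative cumulant_closed (Suc 0) t) (at t)"
    unfolding coth by (simp add: cumulant_closed_def Let_def x_def s_def d_def)
  have 1: "(cumulant_closed 1 has_real_derivative cumulant_closed 2 t) (at t)"
  proof -
    have a: "((\<lambda>t. sinh (2 * t / 3) / (cosh (2 * t / 3) - 1) / 3) has_real_derivative
        2/9 * (x * (x - 1) - s * s) / (x - 1)\<^sup>2) (at t)"
    proof -
      have "((\<lambda>t. sinh (2 * t / 3) / (cosh (2 * t / 3) - 1)) has_real_derivative
          2/3 * (x * (x - 1) - s * s) / (x - 1)\<^sup>2) (at t)"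
        by (rule DERIV_cong[OF DERIV_divide[OF S' X1' nz(1)]])
           (simp add: s_def x_def power2_eq_square algebra_simps diff_divide_distrib)
      from DERIV_cdivide[OF this, of 3] show ?thesis by simp
    qed
    have b: "((\<lambda>t. 4/3 * sinh (2 * t / 3) / (d + 2 * cosh (2 * t / 3))) has_real_derivative
        8/9 * (x * (d + 2 * x) - 2 * (s * s)) / (d + 2 * x)\<^sup>2) (at t)"
    proof -
      define e where "e = d + 2 * x"
      have e: "e \<noteq> 0" using p by (simp add: e_def)
      have *: "(4/3 * (x * (2/3)) * e - 4/3 * s * (2 * (s * (2/3)))) / (e * e)
         = 8/9 * (x * e - 2 * (s * s)) / e\<^sup>2"
        using e by (simp add: divide_simps power2_eq_square)
      show ?thesis
        unfolding e_def[symmetric] *[symmetric]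
        by (rule DERIV_cong[OF DERIV_divide[OF DERIV_cmult[OF S'] E' nz(2)]])
           (simp add: e_def s_def x_def)
    qed
    have c: "((\<lambda>t. 1 / t) has_real_derivative - (1 / t\<^sup>2)) (at t)"
      using assms
      by - ((rule derivative_eq_intros refl)+, auto simp: power2_eq_square divide_simps)
    have D: "(cumulant_closed 1 has_real_derivative
        2/9 * (x * (x - 1) - s * s) / (x - 1)\<^sup>2
        + 8/9 * (x * (d + 2 * x) - 2 * (s * s)) / (d + 2 * x)\<^sup>2 - - (1 / t\<^sup>2)) (at t)"
      using DERIV_diff[OF DERIV_add[OF a b] c]
      unfolding cumulant_closed_def[abs_def] Let_def by (simp add: d_def)
    have "x * (x - 1) - s * s = - (x - 1)" "x * (d + 2 * x) - 2 * (s * s) = d * x + 2"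
      unfolding ss by (simp_all add: algebra_simps)
    moreover have "2/9 * - (x - 1) / (x - 1)\<^sup>2 = - (2/9 / (x - 1))"
      using x by (simp add: power2_eq_square divide_simps) (simp add: algebra_simps)
    ultimately have "cumulant_closed 2 t = 2/9 * (x * (x - 1) - s * s) / (x - 1)\<^sup>2
        + 8/9 * (x * (d + 2 * x) - 2 * (s * s)) / (d + 2 * x)\<^sup>2 - - (1 / t\<^sup>2)"
      by (simp only:) (simp add: cumulant_closed_def Let_def x_def s_def d_def)
    with D show ?thesis by (simp only:)
  qed
  have 2: "(cumulant_closed 2 has_real_derivative cumulant_closed 3 t) (at t)"
  proof -
    have a: "((\<lambda>t. 1 / t\<^sup>2) has_real_derivative - 2 / t ^ 3) (at t)"
      using assms
      by - ((rule derivative_eq_intros refl)+, auto simp: power2_eq_square power3_eq_cube divide_simps)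
    have b: "((\<lambda>t. 2/9 / (cosh (2 * t / 3) - 1)) has_real_derivative - (4/27 * s / (x - 1)\<^sup>2)) (at t)"
      by (rule DERIV_cong[OF DERIV_divide[OF DERIV_const X1' nz(1)]])
         (simp add: x_def power2_eq_square)
    have c: "((\<lambda>t. 8/9 * (d * cosh (2 * t / 3) + 2) / (d + 2 * cosh (2 * t / 3))\<^sup>2) has_real_derivative
        16/27 * s * (d * (d + 2 * x) - 4 * (d * x + 2)) / (d + 2 * x) ^ 3) (at t)"
    proof -
      define e where "e = d + 2 * x"
      have e: "e \<noteq> 0" using p by (simp add: e_def)
      have *: "(8/9 * (d * (2/3 * s)) * e\<^sup>2 - 8/9 * (d * x + 2) * (2 * (4/3 * s * e))) / (e\<^sup>2 * e\<^sup>2)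
         = 16/27 * s * (d * e - 4 * (d * x + 2)) / e ^ 3"
        using e by (simp add: divide_simps power2_eq_square power3_eq_cube) (simp add: algebra_simps)
      have N': "((\<lambda>t. d * cosh (2 * t / 3) + 2) has_real_derivative d * (2/3 * s)) (at t)"
        using DERIV_add[OF DERIV_cmult[OF X'] DERIV_const] by simp
      have "(d + 2 * cosh (2 * t / 3))\<^sup>2 \<noteq> 0" using nz(2) by simp
      from DERIV_divide[OF DERIV_cmult[OF N', of "8/9"] DERIV_power[OF E', of 2] this] show ?thesis
        unfolding e_def[symmetric] *[symmetric]
        by (rule DERIV_cong) (simp add: e_def s_def x_def)
    qed
    have D: "(cumulant_closed 2 has_real_derivative
        - 2 / t ^ 3 - - (4/27 * s / (x - 1)\<^sup>2) +
        16/27 * s * (d * (d + 2 * x) - 4 * (d * x + 2)) / (d + 2 * x) ^ 3) (at t)"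
      using DERIV_add[OF DERIV_diff[OF a b] c]
      unfolding cumulant_closed_def[abs_def] Let_def by (simp add: d_def)
    have "d * (d + 2 * x) - 4 * (d * x + 2) = d\<^sup>2 - 8 - 2 * d * x"
      by (simp add: power2_eq_square algebra_simps)
    then have "cumulant_closed 3 t = - 2 / t ^ 3 - - (4/27 * s / (x - 1)\<^sup>2) +
        16/27 * s * (d * (d + 2 * x) - 4 * (d * x + 2)) / (d + 2 * x) ^ 3"
      by (simp only:) (simp add: cumulant_closed_def Let_def x_def s_def d_def)
    with D show ?thesis by (simp only:)
  qed
  from n show ?thesis using 0 1 2 by (auto simp: numeral_2_eq_2 numeral_3_eq_3)
qed

text \<open>Functions that agree on the open half-line have the same derivatives there, so only n =
  0 is computed, from the factorisation of \<open>mom 0\<close>. That factorisation divides by t,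
  hence t > 0.\<close>

lemma cumulant_eq_closed:
  assumes "n \<le> 3" "t > 0"
  shows "cumulant n t = cumulant_closed n t"
  using assms
proof (induction n arbitrary: t)
  case 0
  then have "sinh (t / 3) > 0" "coshw + 2 * cosh (2 * t / 3) > 0"
    using coshw_props(1) cosh_real_pos[of "2 * t / 3"] by (auto intro: add_pos_pos)
  with 0 show ?case
    using norm_const_pos
    by (simp add: cumulant_def cumulant_closed_def mom0_eq ln_div ln_mult)
next
  case (Suc n)
  have "(cumulant_closed n has_real_derivative cumulant (Suc n) t) (at t)"
  proof (rule has_field_derivative_transform_within_open)
    show "(cumulant n has_real_derivative cumulant (Suc n) t) (at t)"
      using Suc by (intro cumulant_deriv) auto
    show "open {0::real<..}" "t \<in> {0<..}" using Suc by auto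
    show "cumulant n x = cumulant_closed n x" if "x \<in> {0<..}" for x
      using that Suc by simp
  qed
  moreover have "(cumulant_closed n has_real_derivative cumulant_closed (Suc n) t) (at t)"
    using Suc by (intro cumulant_closed_deriv) auto
  ultimately show ?case by (rule DERIV_unique)
qed

text \<open>The right-hand side comes from the second convergent of the continued fraction of
  \<open>arsinh w / (w sqrt(1 + w\<^sup>2))\<close> at \<open>w = sinh(u/2)\<close>.\<close>

lemma less_sinh_pade:
  fixes u :: real
  assumes "u > 0"
  shows "u < sinh u * (14 + cosh u) / (9 + 6 * cosh u)"
proof -
  let ?f = "\<lambda>u::real. sinh u * (14 + cosh u) / (9 + 6 * cosh u) - u"
  have "9 + 6 * cosh v > 0" for v :: real
    using cosh_real_pos[of v] by linarith
  then have nz: "9 + 6 * cosh v > 0" "9 + 6 * cosh v \<noteq> 0" for v :: real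
    by (auto simp: less_imp_neq[THEN not_sym])
  have "?f 0 < ?f u"
  proof (rule DERIV_pos_imp_increasing_open[OF assms])
    fix v :: real assume v: "0 < v" "v < u"
    define x where "x = cosh v"
    define s where "s = sinh v"
    have ss: "s * s = x * x - 1"
      using cosh_square_eq[of v] by (simp add: x_def s_def power2_eq_square)
    have x: "9 + 6 * x \<noteq> 0" "x > 1" using nz[of v] cosh_gt_1[of v] v by (auto simp: x_def)
    have "(?f has_real_derivative
       ((x * (14 + x) + s * s) * (9 + 6 * x) - 6 * (s * s) * (14 + x) - (9 + 6 * x)\<^sup>2) / (9 + 6 * x)\<^sup>2) (at v)"
    proof -
      have "(?f has_real_derivative
        ((x * (14 + x) + s * s) * (9 + 6 * x) - s * (14 + x) * (6 * s)) / ((9 + 6 * x) * (9 + 6 * x)) - 1) (at v)"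
        by (rule derivative_eq_intros refl nz)+ (auto simp: x_def s_def algebra_simps)
      moreover have "((x * (14 + x) + s * s) * (9 + 6 * x) - s * (14 + x) * (6 * s)) / ((9 + 6 * x) * (9 + 6 * x)) - 1
        = ((x * (14 + x) + s * s) * (9 + 6 * x) - 6 * (s * s) * (14 + x) - (9 + 6 * x)\<^sup>2) / (9 + 6 * x)\<^sup>2"
        using x(1) by (simp add: divide_simps power2_eq_square)
      ultimately show ?thesis by simp
    qed
    \<comment> \<open>The numerator collapses to a perfect cube. Near 0 the derivative is about
      v^6/300, so the approximant exceeds u only by about u^7/2100.\<close>
    also have "(x * (14 + x) + s * s) * (9 + 6 * x) - 6 * (s * s) * (14 + x) - (9 + 6 * x)\<^sup>2 = 6 * (x - 1) ^ 3"
      unfolding ss by (simp add: power2_eq_square power3_eq_cube algebra_simps)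
    finally show "\<exists>y. (?f has_real_derivative y) (at v) \<and> 0 < y"
      using x by (intro exI[of _ "6 * (x - 1) ^ 3 / (9 + 6 * x)\<^sup>2"]) auto
  qed (use nz in \<open>auto intro!: continuous_intros\<close>)
  then show ?thesis by simp
qed

text \<open>Here \<open>d\<close> stands for \<open>coshw + 2\<close> and \<open>z\<close> for
  sinh(u/2)^2. The relative error of the approximant has order u^6, that is z^3, so it leaves the
  exact cancellation of the lower coefficients intact. At order z^3 the negative sixth cumulant
  outweighs it.\<close>

lemma pade_polynomial_ineq:
  fixes d z :: real
  assumes d: "d\<^sup>2 = 240 * d - 1440" "d > 6.157" "d < 6.17" and z: "z > 0"
  shows "(1 + z)\<^sup>2 * (15 + 2 * z) ^ 3 * ((d + 4 * z) ^ 3 + 16 * z\<^sup>2 * (d * (d - 6) - 4 * (d - 2) * z))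
    < (15 + 12 * z) ^ 3 * (d + 4 * z) ^ 3"
proof -
  \<comment> \<open>\<open>z\<^sup>2 S\<close> and \<open>z\<^sup>3 Q\<close> are quotient and remainder of the difference modulo \<open>d\<^sup>2 - 240 d + 1440\<close>.\<close>
  define Q where "Q = (178848000 - 28900800 * d) + (210643200 - 33868080 * d) * z
      + (44948160 - 7045152 * d) * z ^ 2 + (4434816 - 656320 * d) * z ^ 3
      + (146688 - 17792 * d) * z ^ 4 + (512 * d - 1536) * z ^ 5"
  define S where "S = 225 * d + (10 * d - 124500) * z + (- 147000 - 196 * d) * z ^ 2
      + (- 31760 - 8 * d) * z ^ 3 - 3232 * z ^ 4 - 128 * z ^ 5"
  have "(15 + 12 * z) ^ 3 * (d + 4 * z) ^ 3 -
      (1 + z)\<^sup>2 * (15 + 2 * z) ^ 3 * ((d + 4 * z) ^ 3 + 16 * z\<^sup>2 * (d * (d - 6) - 4 * (d - 2) * z))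
      = z ^ 3 * Q + z\<^sup>2 * S * (d\<^sup>2 - 240 * d + 1440)"
    unfolding Q_def S_def by algebra
  also have "\<dots> = z ^ 3 * Q" using d(1) by simp
  also have "\<dots> > 0"
  proof -
    \<comment> \<open>All coefficients of \<open>Q\<close> are affine in \<open>d\<close>. The last
      is positive for d > 3, the others for d < 6.188, where the constant coefficient is the
      tightest.\<close>
    have "Q > 0"
      unfolding Q_def using d z
      by (intro add_pos_nonneg mult_nonneg_nonneg zero_le_power) auto
    with z show ?thesis by simp
  qed
  finally show ?thesis by simp
qed

lemma cumulant_closed_3_neg:
  assumes "t > 0"
  shows "cumulant_closed 3 t < 0"
proof -
  define u where "u = 2 * t / 3"
  define x where "x = cosh u"
  define s where "s = sinh u"
  define d where "d = coshw"
  \<comment> \<open>\<open>z\<close> = sinh(u/2)^2 makes the bound on u and the cleared inequality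
    rational, up to the factor \<open>s\<close>.\<close>
  define z where "z = (x - 1) / 2"
  define D where "D = d + 2"
  define P where "P = (D + 4 * z) ^ 3 + 16 * z\<^sup>2 * (D * (D - 6) - 4 * (D - 2) * z)"
  have u: "u > 0" using assms by (simp add: u_def)
  then have x: "x > 1" and s: "s > 0" by (auto simp: x_def s_def cosh_gt_1)
  have z: "z > 0" using x by (simp add: z_def)
  have xz: "x = 1 + 2 * z" 
  proof -
    have "2 * z = x - 1" by (simp add: z_def)
    then show ?thesis by linarith
  qed
  have ss: "s\<^sup>2 = 4 * z * (1 + z)"
    using cosh_square_eq[of u] by (simp add: x_def[symmetric] s_def[symmetric] xz power2_eq_square algebra_simps)
  have D: "D > 0" "D\<^sup>2 = 240 * D - 1440" "D > 6.157" "D < 6.17"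
    using coshw_props by (auto simp: D_def d_def)
  have dx: "d + 2 * x = D + 4 * z" by (simp add: D_def xz)
  have pos: "D + 4 * z > 0" "15 + 12 * z > 0" using D z by auto
  \<comment> \<open>For large \<open>z\<close> the leading coefficient 64 (3 - D) makes
    \<open>P\<close> negative, so the upper bound on u may be inserted only where P > 0; elsewhere
    the signs suffice.\<close>
  have main: "s * u ^ 3 * P < 16 * z\<^sup>2 * (D + 4 * z) ^ 3"
  proof (cases "P \<le> 0")
    case True
    then have "s * u ^ 3 * P \<le> 0" using s u by (intro mult_nonneg_nonpos) auto
    also have "0 < 16 * z\<^sup>2 * (D + 4 * z) ^ 3" using z pos by simp
    finally show ?thesis .
  next
    case False
    define r where "r = (15 + 2 * z) / (15 + 12 * z)"
    have "u < s * r"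
      using less_sinh_pade[OF u] by (simp add: s_def[symmetric] x_def[symmetric] xz r_def algebra_simps)
    then have "u ^ 3 < (s * r) ^ 3" using u by (intro power_strict_mono) auto
    then have "s * u ^ 3 * P < s * (s * r) ^ 3 * P" using s False by simp
    \<comment> \<open>The factor \<open>s\<close> in front completes s^3 to s^4 = (4 z (1 + z))^2,
      so no hyperbolic sine is left.\<close>
    also have "\<dots> = (s\<^sup>2)\<^sup>2 * r ^ 3 * P" by (simp add: power2_eq_square power3_eq_cube)
    also have "\<dots> = 16 * z\<^sup>2 * ((1 + z)\<^sup>2 * (15 + 2 * z) ^ 3 * P / (15 + 12 * z) ^ 3)"
      unfolding ss r_def by (simp add: power_divide power_mult_distrib)
    also have "\<dots> < 16 * z\<^sup>2 * (D + 4 * z) ^ 3"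
      using pade_polynomial_ineq[OF D(2-4) z] z pos
      by (intro mult_strict_left_mono) (auto simp: P_def divide_less_eq mult_ac)
    finally show ?thesis .
  qed
  have "cumulant_closed 3 t = 4/27 * (s / (x - 1)\<^sup>2 + 4 * s * (d\<^sup>2 - 8 - 2 * d * x) / (d + 2 * x) ^ 3 - 4 / u ^ 3)"
    by (simp add: cumulant_closed_def Let_def u_def[symmetric] x_def[symmetric] s_def[symmetric] d_def[symmetric])
       (simp add: u_def field_simps)
  also have "s / (x - 1)\<^sup>2 + 4 * s * (d\<^sup>2 - 8 - 2 * d * x) / (d + 2 * x) ^ 3 - 4 / u ^ 3 =
      s * P / (4 * z\<^sup>2 * (D + 4 * z) ^ 3) - 4 / u ^ 3"
  proof -
    have e: "d\<^sup>2 - 8 - 2 * d * x = D * (D - 6) - 4 * (D - 2) * z"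
      by (simp add: D_def xz power2_eq_square algebra_simps)
    have "(x - 1)\<^sup>2 = 4 * z\<^sup>2" by (simp add: xz power2_eq_square)
    then show ?thesis
      unfolding e dx P_def using z pos by (simp add: divide_simps) (simp add: algebra_simps)
  qed
  also have "\<dots> < 0"
    using main z pos u s by (simp add: divide_simps mult_ac)
  finally show ?thesis by simp
qed

lemma cumulant3_neg: "t > 0 \<Longrightarrow> cumulant 3 t < 0"
  using cumulant_eq_closed[of 3 t] cumulant_closed_3_neg by simp

section \<open>The remainder of the linear response\<close>

definition rho :: "real \<Rightarrow> real" where
  "rho t = cumulant 2 0 * t - cumulant 1 t"

lemma rho_deriv: "(rho has_real_derivative cumulant 2 0 - cumulant 2 t) (at t)"
  unfolding rho_def[abs_def]
  using DERIV_diff[OF DERIV_cmult_Id cumulant_deriv[of 1 t]] by (simp add: numeral_2_eq_2)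

lemma rho_0 [simp]: "rho 0 = 0"
  using cumulants_at_0(2) by (simp add: rho_def)

lemma cumulant1_abs_le: "\<bar>cumulant 1 t\<bar> \<le> 1"
  using rmom_abs_le[of 1 t] by (simp add: cumulant_def)

lemma cumulant2_abs_le: "\<bar>cumulant 2 t\<bar> \<le> 2"
proof -
  have "(rmom 1 t)\<^sup>2 \<le> 1"
    using rmom_abs_le[of 1 t] by (simp add: abs_square_le_1)
  moreover have "cumulant 2 t = rmom 2 t - (rmom 1 t)\<^sup>2" by (simp add: cumulant_def)
  ultimately show ?thesis
    using rmom_abs_le[of 2 t] zero_le_power2[of "rmom 1 t"] by linarith
qed

text \<open>With b = 0 it provides the integrability of the integrand of \<open>G\<close>, in
  general the continuity of \<open>G\<close> in m. The 4 is twice the bound 2 on the second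
  cumulant.\<close>

lemma rho_lipschitz: "\<bar>rho a - rho b\<bar> \<le> 4 * \<bar>a - b\<bar>"
proof -
  have "norm (cumulant 2 0 - cumulant 2 t) \<le> 4" for t
    using cumulant2_abs_le[of 0] cumulant2_abs_le[of t] by (simp add: abs_le_iff)
  then have "norm (rho a - rho b) \<le> 4 * norm (a - b)"
    by (intro field_differentiable_bound[of UNIV rho]) (auto intro: rho_deriv)
  then show ?thesis by simp
qed

lemma rho_measurable [measurable]: "rho \<in> borel_measurable borel"
  by (intro borel_measurable_continuous_onI continuous_at_imp_continuous_on ballI
      DERIV_isCont[OF rho_deriv])

lemma cumulant2_strict_antimono:
  assumes "0 \<le> a" "a < b"
  shows "cumulant 2 b < cumulant 2 a"
proof (rule DERIV_neg_imp_decreasing_open[OF assms(2)])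
  have d: "(cumulant 2 has_real_derivative cumulant 3 x) (at x)" for x
    using cumulant_deriv[of 2 x] by (simp add: numeral_3_eq_3)
  show "\<exists>y. (cumulant 2 has_real_derivative y) (at x) \<and> y < 0" if "a < x" for x
    using that assms d cumulant3_neg[of x] by auto
  show "continuous_on {a..b} (cumulant 2)"
    by (intro continuous_at_imp_continuous_on ballI DERIV_isCont[OF d])
qed

lemma rho_strict_mono:
  assumes "0 \<le> a" "a < b"
  shows "rho a < rho b"
proof (rule DERIV_pos_imp_increasing_open[OF assms(2)])
  show "\<exists>y. (rho has_real_derivative y) (at x) \<and> 0 < y" if "a < x" for x
    using that assms rho_deriv[of x] cumulant2_strict_antimono[of 0 x] by auto
  show "continuous_on {a..b} rho"
    by (intro continuous_at_imp_continuous_on ballI DERIV_isCont[OF rho_deriv])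
qed

lemma rho_pos: "t > 0 \<Longrightarrow> rho t > 0"
  using rho_strict_mono[of 0 t] by simp

text \<open>The derivative of \<open>rho\<close> increases strictly, so the chord over [0,a] is
  flatter than the chord over [a,b]; since \<open>rho\<close> vanishes at 0, the ratio is the slope
  of the chord from the origin.\<close>

lemma rho_div_strict_mono:
  assumes "0 < a" "a < b"
  shows "rho a / a < rho b / b"
proof -
  obtain p where p: "0 < p" "p < a" "rho a - rho 0 = (a - 0) * (cumulant 2 0 - cumulant 2 p)"
    using MVT2[of 0 a rho "\<lambda>x. cumulant 2 0 - cumulant 2 x"] assms rho_deriv by auto
  obtain q where q: "a < q" "q < b" "rho b - rho a = (b - a) * (cumulant 2 0 - cumulant 2 q)"
    using MVT2[of a b rho "\<lambda>x. cumulant 2 0 - cumulant 2 x"] assms rho_deriv by auto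
  have "cumulant 2 q < cumulant 2 p"
    using p q by (intro cumulant2_strict_antimono) auto
  then have "(b - a) * (cumulant 2 0 - cumulant 2 p) < rho b - rho a"
    unfolding q(3) using assms by (intro mult_strict_left_mono) auto
  moreover have "rho a = a * (cumulant 2 0 - cumulant 2 p)" using p(3) by simp
  ultimately have "b * (cumulant 2 0 - cumulant 2 p) < rho b"
    by (simp add: algebra_simps)
  moreover have "rho a / a = cumulant 2 0 - cumulant 2 p"
    using p(3) assms by simp
  ultimately show ?thesis
    using assms by (simp add: less_divide_eq mult.commute)
qed

text \<open>The mean \<open>cumulant 1\<close> is expanded to order five. Among the cumulants 1 to 5
  at 0 only the second is nonzero, and \<open>rho\<close> subtracts exactly that term.\<close>

lemma rho_taylor:
  assumes "h > 0"
  obtains t where "0 < t" "t < h" "rho h = - cumulant 6 t / 120 * h ^ 5"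
proof -
  have "\<exists>t. 0 < t \<and> t < h \<and> cumulant 1 h =
      (\<Sum>m<5. cumulant (Suc m) 0 / fact m * h ^ m) + cumulant (Suc 5) t / fact 5 * h ^ 5"
    by (rule Maclaurin[OF assms, where diff = "\<lambda>m. cumulant (Suc m)"])
       (auto intro: cumulant_deriv)
  then obtain t where t: "0 < t" "t < h" "cumulant 1 h =
      (\<Sum>m<5. cumulant (Suc m) 0 / fact m * h ^ m) + cumulant (Suc 5) t / fact 5 * h ^ 5" by blast
  have "(\<Sum>m<5. cumulant (Suc m) 0 / fact m * h ^ m) = cumulant 2 0 * h"
    using cumulants_at_0 by (simp add: eval_nat_numeral)
  with t(3) have "rho h = - cumulant 6 t / 120 * h ^ 5"
    by (simp add: rho_def fact_numeral)
  with t that show thesis by blast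
qed

text \<open>Two regimes are glued at some d <= 1. Below d, continuity of \<open>cumulant 6\<close>
  controls the Taylor remainder. Above d, the lower bound is monotonicity of rho(t)/t and the upper
  bound comes from the boundedness of the mean.\<close>

lemma rho_bounds:
  obtains A B where "A > 0" "B > 0"
    "\<And>t. t \<ge> 0 \<Longrightarrow> A * min (t ^ 5) t \<le> rho t"
    "\<And>t. t \<ge> 0 \<Longrightarrow> rho t \<le> B * min (t ^ 5) t"
proof -
  define q where "q = - cumulant 6 0"
  define v where "v = cumulant 2 0"
  have q: "q > 0" and v: "v > 0" using cumulants_at_0 by (auto simp: q_def v_def)
  have "continuous_on UNIV (cumulant 6)"
    unfolding cumulant_def[abs_def] Let_def by (auto intro!: continuous_intros)
  then have "isCont (cumulant 6) 0"
    by (simp add: continuous_on_eq_continuous_at)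
  then have "eventually (\<lambda>t. dist (cumulant 6 t) (cumulant 6 0) < q / 2) (nhds 0)"
    using q by (intro tendstoD) (auto simp: isCont_def tendsto_at_iff_tendsto_nhds)
  then obtain d0 where d0: "d0 > 0" "\<And>t. dist t 0 < d0 \<Longrightarrow> dist (cumulant 6 t) (cumulant 6 0) < q / 2"
    by (auto simp: eventually_nhds_metric)
  define d where "d = min d0 1"
  have d: "0 < d" "d \<le> 1" using d0 by (auto simp: d_def)
  \<comment> \<open>The constants are (q/2)/120 and (3q/2)/120, because - \<open>cumulant 6\<close>
    stays between q/2 and 3q/2 on this range.\<close>
  have small: "q / 240 * t ^ 5 \<le> rho t \<and> rho t \<le> q / 80 * t ^ 5" if t: "0 < t" "t \<le> d" for t
  proof -
    obtain s where s: "0 < s" "s < t" "rho t = - cumulant 6 s / 120 * t ^ 5"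
      using rho_taylor[OF t(1)] by blast
    have "dist (cumulant 6 s) (cumulant 6 0) < q / 2"
      using s t by (intro d0) (auto simp: d_def)
    then have "- cumulant 6 s \<ge> q / 2" "- cumulant 6 s \<le> 3 * q / 2"
      by (auto simp: q_def dist_real_def abs_if split: if_splits)
    then show ?thesis
      unfolding s(3) using t by (intro conjI mult_right_mono) auto
  qed
  define a where "a = rho d / d"
  \<comment> \<open>The division by d^4 pays for the comparison d^4 t <= min(t^5, t), valid for t >=
    d.\<close>
  define b where "b = (v + 1 / d) / d ^ 4"
  have a: "a > 0" and b: "b > 0" using d v rho_pos[of d] by (auto simp: a_def b_def add_pos_pos)
  have large: "a * t \<le> rho t" "rho t \<le> b * (d ^ 4 * t)" if "d \<le> t" for t
  proof -
    have "a \<le> rho t / t"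
      using rho_div_strict_mono[of d t] that d by (cases "d = t") (auto simp: a_def)
    then show "a * t \<le> rho t" using that d by (simp add: le_divide_eq)
    have "rho t \<le> v * t + 1"
      using cumulant1_abs_le[of t] by (simp add: rho_def v_def abs_le_iff)
    also have "1 \<le> t / d" using that d by simp
    then have "v * t + 1 \<le> (v + 1 / d) * t" by (simp add: algebra_simps)
    also have "\<dots> = b * (d ^ 4 * t)" using d by (simp add: b_def)
    finally show "rho t \<le> b * (d ^ 4 * t)" by simp
  qed
  have m1: "min (t ^ 5) t = t ^ 5" if "0 \<le> t" "t \<le> 1" for t :: real
    using power_decreasing[of 1 5 t] that by simp
  have m2: "d ^ 4 * t \<le> min (t ^ 5) t" if "d \<le> t" for t
  proof -
    have "d ^ 4 * t \<le> t ^ 4 * t" using that d by (intro mult_right_mono power_mono) auto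
    moreover have "d ^ 4 * t \<le> 1 * t" using that d by (intro mult_right_mono power_le_one) auto
    ultimately show ?thesis by (simp add: power_Suc2[symmetric] del: power_Suc)
  qed
  have mn: "min (t ^ 5) t \<ge> 0" if "t \<ge> 0" for t :: real using that by simp
  show thesis
  proof (rule that[of "min (q / 240) a" "max (q / 80) b"])
    fix t :: real assume t: "t \<ge> 0"
    show "min (q / 240) a * min (t ^ 5) t \<le> rho t"
    proof (cases "t \<le> d")
      case True
      have "min (q / 240) a * min (t ^ 5) t \<le> q / 240 * min (t ^ 5) t"
        by (intro mult_right_mono mn t) auto
      also have "\<dots> \<le> rho t" using small[of t] True t d m1[of t] by (cases "t = 0") auto
      finally show ?thesis .
    next
      case False
      have "min (q / 240) a * min (t ^ 5) t \<le> a * t"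
        using a q t by (intro mult_mono) auto
      also have "\<dots> \<le> rho t" using large False by auto
      finally show ?thesis .
    qed
    show "rho t \<le> max (q / 80) b * min (t ^ 5) t"
    proof (cases "t \<le> d")
      case True
      have "rho t \<le> q / 80 * min (t ^ 5) t" using small[of t] True t d m1[of t] by (cases "t = 0") auto
      also have "\<dots> \<le> max (q / 80) b * min (t ^ 5) t"
        by (intro mult_right_mono mn t) auto
      finally show ?thesis .
    next
      case False
      have "rho t \<le> b * (d ^ 4 * t)" using large False by auto
      also have "\<dots> \<le> max (q / 80) b * min (t ^ 5) t"
        using m2[of t] False b d t by (intro mult_mono) auto
      finally show ?thesis .
    qed
  qed (use a b q in auto)
qed

section \<open>The fixed point equation\<close>

lemma (in prob_space) expectation_strict_mono:
  fixes f g :: "'a \<Rightarrow> real"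
  assumes "integrable M f" "integrable M g" "\<And>\<omega>. \<omega> \<in> space M \<Longrightarrow> f \<omega> < g \<omega>"
  shows "expectation f < expectation g"
  using assms emeasure_space_1 by (intro integral_less_AE_space AE_I2) auto

locale weight = prob_space M for M :: "'a measure" +
  fixes W :: "'a \<Rightarrow> real"
  assumes W_measurable [measurable]: "W \<in> borel_measurable M"
    and W_pos: "\<And>\<omega>. \<omega> \<in> space M \<Longrightarrow> W \<omega> > 0"
    and W_square_integrable: "integrable M (\<lambda>\<omega>. (W \<omega>)\<^sup>2)"
begin

lemma W_integrable: "integrable M W"
proof (rule Bochner_Integration.integrable_bound)
  show "integrable M (\<lambda>\<omega>. 1 + (W \<omega>)\<^sup>2)" using W_square_integrable by simp
  show "AE \<omega> in M. norm (W \<omega>) \<le> norm (1 + (W \<omega>)\<^sup>2)"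
  proof (intro AE_I2)
    fix \<omega>
    have "2 * \<bar>W \<omega>\<bar> \<le> 1 + (W \<omega>)\<^sup>2"
      using zero_le_power2[of "\<bar>W \<omega>\<bar> - 1"] by (simp add: power2_eq_square algebra_simps)
    then show "norm (W \<omega>) \<le> norm (1 + (W \<omega>)\<^sup>2)" by simp
  qed
qed simp

lemma expectation_pos:
  assumes "integrable M f" "\<And>\<omega>. \<omega> \<in> space M \<Longrightarrow> (f \<omega> :: real) > 0"
  shows "expectation f > 0"
  using expectation_strict_mono[of "\<lambda>_. 0" f] assms by simp

definition EW :: real where "EW = expectation W"
definition EW2 :: real where "EW2 = expectation (\<lambda>\<omega>. (W \<omega>)\<^sup>2)"

lemma EW_pos: "EW > 0" and EW2_pos: "EW2 > 0"
  unfolding EW_def EW2_def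
  by (auto intro!: expectation_pos W_integrable W_square_integrable zero_less_power W_pos)

text \<open>Up to sign, the nonlinear part of \<open>EW * phi M W h m\<close>; the factor
  \<open>EW\<close> clears the size-bias normalisation.\<close>

definition G :: "real \<Rightarrow> real \<Rightarrow> real" where
  "G m h = expectation (\<lambda>\<omega>. W \<omega> * rho (W \<omega> * m + h))"

text \<open>The integrand is W min((W m)^5, W m) divided by m, for m > 0. Its second branch keeps it
  integrable under a second moment alone.\<close>

definition K :: "real \<Rightarrow> real" where
  "K m = expectation (\<lambda>\<omega>. min (W \<omega> ^ 6 * m ^ 4) ((W \<omega>)\<^sup>2))"

lemma W_affine_integrable: "integrable M (\<lambda>\<omega>. W \<omega> * (W \<omega> * m + h))"
proof -
  have "integrable M (\<lambda>\<omega>. (W \<omega>)\<^sup>2 * m + W \<omega> * h)"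
    using W_integrable W_square_integrable by simp
  then show ?thesis by (simp add: power2_eq_square algebra_simps)
qed

lemma G_integrable: "integrable M (\<lambda>\<omega>. W \<omega> * rho (W \<omega> * m + h))"
proof (rule Bochner_Integration.integrable_bound)
  show "integrable M (\<lambda>\<omega>. 4 * (W \<omega> * (W \<omega> * m + h)))"
    using W_affine_integrable[of m h] by simp
  show "AE \<omega> in M. norm (W \<omega> * rho (W \<omega> * m + h)) \<le> norm (4 * (W \<omega> * (W \<omega> * m + h)))"
  proof (intro AE_I2)
    fix \<omega>
    have "\<bar>W \<omega>\<bar> * \<bar>rho (W \<omega> * m + h)\<bar> \<le> \<bar>W \<omega>\<bar> * (4 * \<bar>W \<omega> * m + h\<bar>)"
      using rho_lipschitz[of "W \<omega> * m + h" 0] by (intro mult_left_mono) auto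
    then show "norm (W \<omega> * rho (W \<omega> * m + h)) \<le> norm (4 * (W \<omega> * (W \<omega> * m + h)))"
      by (simp add: abs_mult)
  qed
qed simp

lemma K_integrable: "integrable M (\<lambda>\<omega>. min (W \<omega> ^ 6 * m ^ 4) ((W \<omega>)\<^sup>2))"
  by (rule Bochner_Integration.integrable_bound[OF W_square_integrable]) (auto intro!: AE_I2)

lemma K_pos: "m \<noteq> 0 \<Longrightarrow> K m > 0"
  unfolding K_def using W_pos by (intro expectation_pos K_integrable) (auto simp: less_imp_neq[THEN not_sym])

lemma G_lipschitz: "\<bar>G m h - G m' h\<bar> \<le> 4 * EW2 * \<bar>m - m'\<bar>"
proof -
  have "\<bar>G m h - G m' h\<bar> =
      \<bar>expectation (\<lambda>\<omega>. W \<omega> * rho (W \<omega> * m + h) - W \<omega> * rho (W \<omega> * m' + h))\<bar>"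
    unfolding G_def by (simp add: G_integrable)
  also have "\<dots> \<le> expectation (\<lambda>\<omega>. 4 * \<bar>m - m'\<bar> * (W \<omega>)\<^sup>2)"
  proof (rule order_trans[OF integral_abs_bound], rule integral_mono)
    fix \<omega>
    have "\<bar>W \<omega>\<bar> * \<bar>rho (W \<omega> * m + h) - rho (W \<omega> * m' + h)\<bar> \<le> \<bar>W \<omega>\<bar> * (4 * \<bar>(W \<omega> * m + h) - (W \<omega> * m' + h)\<bar>)"
      by (intro mult_left_mono rho_lipschitz) auto
    also have "\<dots> = 4 * \<bar>m - m'\<bar> * (W \<omega>)\<^sup>2"
    proof -
      have "(W \<omega> * m + h) - (W \<omega> * m' + h) = W \<omega> * (m - m')" by (simp add: algebra_simps)
      then show ?thesis by (simp add: abs_mult power2_eq_square)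
    qed
    finally show "\<bar>W \<omega> * rho (W \<omega> * m + h) - W \<omega> * rho (W \<omega> * m' + h)\<bar> \<le> 4 * \<bar>m - m'\<bar> * (W \<omega>)\<^sup>2"
      by (simp add: abs_mult right_diff_distrib[symmetric])
  qed (use W_square_integrable G_integrable in auto)
  finally show ?thesis by (simp add: EW2_def mult_ac)
qed

lemma G_continuous: "continuous_on S (\<lambda>m. G m h)"
proof -
  have "(4 * EW2)-lipschitz_on S (\<lambda>m. G m h)"
    using G_lipschitz EW2_pos by (intro lipschitz_onI) (auto simp: dist_real_def)
  then show ?thesis by (rule lipschitz_on_continuous_on)
qed

lemma G_strict_mono:
  assumes "0 \<le> m" "m < m'" "0 \<le> h"
  shows "G m h < G m' h"
  unfolding G_def
proof (intro expectation_strict_mono G_integrable mult_strict_left_mono rho_strict_mono)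
  fix \<omega> assume "\<omega> \<in> space M"
  then show "W \<omega> > 0" "0 \<le> W \<omega> * m + h" "W \<omega> * m + h < W \<omega> * m' + h"
    using assms W_pos by (auto intro!: add_nonneg_nonneg mult_nonneg_nonneg intro: less_imp_le)
qed

lemma G_mono: "0 \<le> m \<Longrightarrow> 0 \<le> h \<Longrightarrow> G m 0 \<le> G m h"
  unfolding G_def
proof (intro integral_mono G_integrable mult_left_mono)
  fix \<omega> assume *: "\<omega> \<in> space M" "0 \<le> m" "0 \<le> h"
  then show "0 \<le> W \<omega>" using W_pos by (simp add: less_imp_le)
  then show "rho (W \<omega> * m + 0) \<le> rho (W \<omega> * m + h)"
    using rho_strict_mono[of "W \<omega> * m" "W \<omega> * m + h"] * by (cases "h = 0") auto
qed

lemma G_0: "G 0 h = EW * rho h"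
  by (simp add: G_def EW_def)

text \<open>Factoring W^2 out of the integrand leaves rho(W m)/(W m). At h = 0 the equation
  prescribes the value of this quotient, so its strict growth gives uniqueness.\<close>

lemma G_div_strict_mono:
  assumes "0 < m" "m < m'"
  shows "G m 0 / m < G m' 0 / m'"
proof -
  have "expectation (\<lambda>\<omega>. W \<omega> * rho (W \<omega> * m + 0) / m) < expectation (\<lambda>\<omega>. W \<omega> * rho (W \<omega> * m' + 0) / m')"
  proof (intro expectation_strict_mono integrable_divide G_integrable)
    fix \<omega> assume "\<omega> \<in> space M"
    then have W: "W \<omega> > 0" by (rule W_pos)
    then have "(W \<omega>)\<^sup>2 * (rho (W \<omega> * m) / (W \<omega> * m)) < (W \<omega>)\<^sup>2 * (rho (W \<omega> * m') / (W \<omega> * m'))"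
      using assms by (intro mult_strict_left_mono rho_div_strict_mono) auto
    then show "W \<omega> * rho (W \<omega> * m + 0) / m < W \<omega> * rho (W \<omega> * m' + 0) / m'"
      using W by (simp add: power2_eq_square)
  qed
  then show ?thesis by (simp add: G_def)
qed

lemma G_bounds:
  obtains A B where "A > 0" "B > 0"
    "\<And>m. m > 0 \<Longrightarrow> A * (m * K m) \<le> G m 0" "\<And>m. m > 0 \<Longrightarrow> G m 0 \<le> B * (m * K m)"
proof -
  obtain A B where AB: "A > 0" "B > 0"
    "\<And>t. t \<ge> 0 \<Longrightarrow> A * min (t ^ 5) t \<le> rho t" "\<And>t. t \<ge> 0 \<Longrightarrow> rho t \<le> B * min (t ^ 5) t"
    using rho_bounds by blast
  have eq: "W \<omega> * min ((W \<omega> * m) ^ 5) (W \<omega> * m) = m * min (W \<omega> ^ 6 * m ^ 4) ((W \<omega>)\<^sup>2)"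
    if "m > 0" "\<omega> \<in> space M" for m \<omega>
  proof -
    have "W \<omega> > 0" using that W_pos by simp
    then have "W \<omega> * min ((W \<omega> * m) ^ 5) (W \<omega> * m) = min (W \<omega> * (W \<omega> * m) ^ 5) (W \<omega> * (W \<omega> * m))"
      by (simp add: min_mult_distrib_left)
    also have "\<dots> = min (m * (W \<omega> ^ 6 * m ^ 4)) (m * (W \<omega>)\<^sup>2)"
      by (simp add: power_mult_distrib power2_eq_square eval_nat_numeral mult_ac)
    finally show ?thesis using that by (simp add: min_mult_distrib_left)
  qed
  have K: "m * K m * c = expectation (\<lambda>\<omega>. c * (W \<omega> * min ((W \<omega> * m) ^ 5) (W \<omega> * m)))"
    and Ki: "integrable M (\<lambda>\<omega>. c * (W \<omega> * min ((W \<omega> * m) ^ 5) (W \<omega> * m)))"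
    if "m > 0" for m c
  proof -
    have "expectation (\<lambda>\<omega>. c * (W \<omega> * min ((W \<omega> * m) ^ 5) (W \<omega> * m))) =
        expectation (\<lambda>\<omega>. c * (m * min (W \<omega> ^ 6 * m ^ 4) ((W \<omega>)\<^sup>2)))"
      by (intro Bochner_Integration.integral_cong) (simp_all add: eq that)
    then show "m * K m * c = expectation (\<lambda>\<omega>. c * (W \<omega> * min ((W \<omega> * m) ^ 5) (W \<omega> * m)))"
      by (auto simp: K_def)
    have "integrable M (\<lambda>\<omega>. c * (W \<omega> * min ((W \<omega> * m) ^ 5) (W \<omega> * m))) \<longleftrightarrow>
        integrable M (\<lambda>\<omega>. c * (m * min (W \<omega> ^ 6 * m ^ 4) ((W \<omega>)\<^sup>2)))"
      by (intro Bochner_Integration.integrable_cong) (simp_all add: eq that)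
    then show "integrable M (\<lambda>\<omega>. c * (W \<omega> * min ((W \<omega> * m) ^ 5) (W \<omega> * m)))"
      using K_integrable by simp
  qed
  show thesis
  proof (rule that[OF AB(1,2)])
    fix m :: real assume m: "m > 0"
    have W: "W \<omega> \<ge> 0" "W \<omega> * m \<ge> 0" if "\<omega> \<in> space M" for \<omega>
      using W_pos[OF that] m by simp_all
    have "expectation (\<lambda>\<omega>. A * (W \<omega> * min ((W \<omega> * m) ^ 5) (W \<omega> * m))) \<le> G m 0"
      unfolding G_def
    proof (intro integral_mono Ki m G_integrable)
      fix \<omega> assume "\<omega> \<in> space M"
      from mult_left_mono[OF AB(3)[OF W(2)[OF this]] W(1)[OF this]]
      show "A * (W \<omega> * min ((W \<omega> * m) ^ 5) (W \<omega> * m)) \<le> W \<omega> * rho (W \<omega> * m + 0)"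
        by (simp only: mult_ac add_0_right)
    qed
    then show "A * (m * K m) \<le> G m 0" unfolding mult.commute[of A "m * K m"] K[OF m] .
    have "G m 0 \<le> expectation (\<lambda>\<omega>. B * (W \<omega> * min ((W \<omega> * m) ^ 5) (W \<omega> * m)))"
      unfolding G_def
    proof (intro integral_mono Ki m G_integrable)
      fix \<omega> assume "\<omega> \<in> space M"
      from mult_left_mono[OF AB(4)[OF W(2)[OF this]] W(1)[OF this]]
      show "W \<omega> * rho (W \<omega> * m + 0) \<le> B * (W \<omega> * min ((W \<omega> * m) ^ 5) (W \<omega> * m))"
        by (simp only: mult_ac add_0_right)
    qed
    then show "G m 0 \<le> B * (m * K m)" unfolding mult.commute[of B "m * K m"] K[OF m] .
  qed
qed

section \<open>Removing the linear part from the fixed point equation\<close>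

lemma phi_eq: "EW * phi M W h m = cumulant 2 0 * (EW2 * m + EW * h) - G m h"
proof -
  have "EW * phi M W h m = expectation (\<lambda>\<omega>. W \<omega> * cumulant 1 (W \<omega> * m + h))"
    using EW_pos
    by (simp add: phi_def sb_expectation_def EW_def cumulant_def rmom_def mom_def g0_def)
  also have "\<dots> = expectation (\<lambda>\<omega>. cumulant 2 0 * (W \<omega> * (W \<omega> * m + h)) - W \<omega> * rho (W \<omega> * m + h))"
    by (simp add: rho_def algebra_simps)
  also have "\<dots> = cumulant 2 0 * expectation (\<lambda>\<omega>. W \<omega> * (W \<omega> * m + h)) - G m h"
    using W_affine_integrable[of m h] G_integrable[of m h] by (simp add: G_def)
  also have "expectation (\<lambda>\<omega>. W \<omega> * (W \<omega> * m + h)) = expectation (\<lambda>\<omega>. (W \<omega>)\<^sup>2 * m + W \<omega> * h)"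
    by (simp add: power2_eq_square algebra_simps)
  also have "\<dots> = EW2 * m + EW * h"
    using W_integrable W_square_integrable by (simp add: EW_def EW2_def)
  finally show ?thesis .
qed

lemma theta_c_eq: "theta_c M W = EW / (EW2 * cumulant 2 0)"
proof -
  have "mom 0 0 = 1" using prob_space.prob_space[OF prob_space_alpha0] by (simp add: mom_def)
  moreover have "rmom 1 0 = 0" by (rule rmom_odd_at_0) simp
  ultimately have "cumulant 2 0 = (\<integral>\<sigma>. (g0 \<sigma>)\<^sup>2 \<partial>alpha0)"
    by (simp add: cumulant_def rmom_def mom_def g0_def)
  then show ?thesis
    by (simp add: theta_c_def sb_expectation_def EW_def EW2_def power2_eq_square)
qed

lemma theta_c_pos: "theta_c M W > 0"
  using EW_pos EW2_pos cumulants_at_0 by (simp add: theta_c_eq)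

text \<open>The slope of the linear part of \<open>phi\<close> in m is
  \<open>EW2 * cumulant 2 0 / EW\<close>, which is 1 / \<open>theta_c\<close>. Only the deviation of
  1/theta from it remains beside \<open>G\<close>.\<close>

lemma fixed_point_iff:
  assumes "\<theta> > 0"
  shows "m / \<theta> = phi M W h m \<longleftrightarrow>
    G m h = EW * (1 / theta_c M W - 1 / \<theta>) * m + cumulant 2 0 * EW * h"
proof -
  have "m / \<theta> = phi M W h m \<longleftrightarrow> EW * (m / \<theta>) = EW * phi M W h m"
    using EW_pos by (simp only: mult_cancel_left) auto
  also have "\<dots> \<longleftrightarrow> EW * (m / \<theta>) = cumulant 2 0 * (EW2 * m + EW * h) - G m h"
    unfolding phi_eq ..
  also have "cumulant 2 0 * EW2 = EW * (1 / theta_c M W)"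
    using EW_pos EW2_pos cumulants_at_0 by (simp add: theta_c_eq mult.commute)
  then have "cumulant 2 0 * (EW2 * m + EW * h) = EW * (1 / theta_c M W) * m + cumulant 2 0 * EW * h"
    by (simp add: distrib_left flip: mult.assoc)
  finally show ?thesis by (auto simp: algebra_simps)
qed

text \<open>The difference of the two sides of the equation for \<open>G\<close> is negative at some
  small m because K(m) tends to 0, and positive at \<open>d\<close> once theta is close to critical.
  The intermediate value theorem gives a root, and growth of \<open>G m 0 / m\<close> makes it the
  only positive one. As \<open>d\<close> is arbitrary, \<open>m_plus\<close> tends to 0.\<close>

lemma m_plus_zero_field:
  assumes K0: "(K \<longlongrightarrow> 0) (at_right 0)" and d: "d > 0"
  shows "\<forall>\<^sub>F \<theta> in at_right (theta_c M W). 0 < m_plus M W \<theta> 0 \<and> m_plus M W \<theta> 0 < d \<and>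
    G (m_plus M W \<theta> 0) 0 = EW * (1 / theta_c M W - 1 / \<theta>) * m_plus M W \<theta> 0"
proof -
  obtain A B where AB: "A > 0" "B > 0" "\<And>m. m > 0 \<Longrightarrow> A * (m * K m) \<le> G m 0"
     "\<And>m. m > 0 \<Longrightarrow> G m 0 \<le> B * (m * K m)" using G_bounds by blast
  define e where "e = (\<lambda>\<theta>. EW * (1 / theta_c M W - 1 / \<theta>))"
  have "(e \<longlongrightarrow> EW * (1 / theta_c M W - 1 / theta_c M W)) (at_right (theta_c M W))"
    unfolding e_def using theta_c_pos by (intro tendsto_intros) auto
  moreover have Gd: "0 < G d 0 / d"
  proof -
    have "0 < A * (d * K d)" using AB d K_pos[of d] by simp
    with AB(3)[OF d] d show ?thesis by simp
  qed
  ultimately have "\<forall>\<^sub>F \<theta> in at_right (theta_c M W). e \<theta> < G d 0 / d"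
    by (auto intro: order_tendstoD)
  moreover have "\<forall>\<^sub>F \<theta> in at_right (theta_c M W). theta_c M W < \<theta>"
    by (auto simp: eventually_at_filter)
  ultimately show ?thesis
  proof eventually_elim
    case (elim \<theta>)
    have th: "\<theta> > 0" using elim theta_c_pos by simp
    have e: "e \<theta> > 0"
      unfolding e_def using elim theta_c_pos EW_pos th by (simp add: divide_strict_left_mono)
    have iff: "m / \<theta> = phi M W 0 m \<longleftrightarrow> G m 0 = e \<theta> * m" for m
      using fixed_point_iff[OF th, of m 0] by (simp add: e_def)
    have "\<forall>\<^sub>F m in at_right 0. K m < e \<theta> / B"
      using K0 e AB by (intro order_tendstoD) auto
    moreover have "\<forall>\<^sub>F m::real in at_right 0. 0 < m \<and> m < d"
      using d by (auto simp: eventually_at_right intro!: exI[of _ d])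
    ultimately have "\<forall>\<^sub>F m in at_right 0. K m < e \<theta> / B \<and> 0 < m \<and> m < d"
      by eventually_elim auto
    then obtain m0 where m0: "K m0 < e \<theta> / B" "0 < m0" "m0 < d"
      using eventually_happens'[OF trivial_limit_at_right_real] by blast
    have "G m0 0 \<le> m0 * (B * K m0)" using AB(4)[OF m0(2)] by (simp add: mult_ac)
    also have "\<dots> < m0 * e \<theta>" using m0 AB by (simp add: less_divide_eq mult.commute)
    finally have 1: "G m0 0 - e \<theta> * m0 < 0" by (simp add: mult.commute)
    have 2: "G d 0 - e \<theta> * d > 0" using elim d by (simp add: less_divide_eq)
    have "continuous_on {m0..d} (\<lambda>m. G m 0 - e \<theta> * m)"
      by (intro continuous_intros G_continuous)
    with IVT'[of "\<lambda>m. G m 0 - e \<theta> * m" m0 0 d] 1 2 m0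
    obtain m where m: "m0 \<le> m" "m \<le> d" "G m 0 - e \<theta> * m = 0"
      by (auto simp del: eq_iff_diff_eq_0 right_minus_eq)
    have uniq: "m' = m" if "m' > 0" "G m' 0 = e \<theta> * m'" for m'
    proof -
      have "G m' 0 / m' = G m 0 / m" using that m m0 by simp
      moreover have "m > 0" using m m0 by linarith
      ultimately show ?thesis
        using G_div_strict_mono[of m m'] G_div_strict_mono[of m' m] that(1)
        by (metis less_irrefl linorder_neqE)
    qed
    have "m_plus M W \<theta> 0 = (THE m. m > 0 \<and> G m 0 = e \<theta> * m)"
      by (simp add: m_plus_def iff)
    also have "\<dots> = m"
      using m m0 uniq by (intro the_equality) auto
    finally show ?case using m m0 2 unfolding e_def by (cases "m = d") simp_all
  qed
qed

text \<open>At m = 0 the left side is \<open>EW * rho h\<close>, of order h^5 and so below the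
  linear right side; at m = d it is at least \<open>G d 0\<close>, a positive constant. Strict
  growth of \<open>G\<close> in m makes the root unique.\<close>

lemma m_plus_critical:
  assumes d: "d > 0"
  shows "\<forall>\<^sub>F h in at_right 0. 0 < m_plus M W (theta_c M W) h \<and> m_plus M W (theta_c M W) h < d \<and>
    G (m_plus M W (theta_c M W) h) h = cumulant 2 0 * EW * h"
proof -
  define v where "v = cumulant 2 0"
  have v: "v > 0" using cumulants_at_0 by (simp add: v_def)
  obtain A B where AB: "A > 0" "B > 0"
    "\<And>t. t \<ge> 0 \<Longrightarrow> A * min (t ^ 5) t \<le> rho t" "\<And>t. t \<ge> 0 \<Longrightarrow> rho t \<le> B * min (t ^ 5) t"
    using rho_bounds by blast
  have "((\<lambda>h. v * EW * h) \<longlongrightarrow> v * EW * 0) (at_right 0)"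
    by (intro tendsto_intros)
  moreover have "0 < G d 0" using G_strict_mono[of 0 d 0] d by (simp add: G_0)
  ultimately have "\<forall>\<^sub>F h in at_right 0. v * EW * h < G d 0"
    by (auto intro: order_tendstoD)
  moreover have "\<forall>\<^sub>F h::real in at_right 0. 0 < h"
    by (auto simp: eventually_at_filter)
  moreover have "((\<lambda>h. B * h ^ 4) \<longlongrightarrow> B * 0 ^ 4) (at_right 0)"
    by (intro tendsto_intros)
  then have "\<forall>\<^sub>F h in at_right 0. B * h ^ 4 < v"
    using v by (intro order_tendstoD) auto
  ultimately show ?thesis
  proof eventually_elim
    case (elim h)
    have iff: "m / theta_c M W = phi M W h m \<longleftrightarrow> G m h = v * EW * h" for m
      using fixed_point_iff[OF theta_c_pos, of m h] by (simp add: v_def)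
    have "rho h \<le> B * h ^ 5" using AB(4)[of h] AB(2) elim(2)
        mult_left_mono[of "min (h ^ 5) h" "h ^ 5" B] by linarith
    also have "\<dots> = (B * h ^ 4) * h" by (simp add: eval_nat_numeral)
    also have "\<dots> < v * h" using elim by simp
    finally have 1: "G 0 h < v * EW * h" using EW_pos by (simp add: G_0)
    have 2: "v * EW * h < G d h" using elim G_mono[of d h] d by simp
    obtain m where m: "0 \<le> m" "m \<le> d" "G m h = v * EW * h"
      using IVT'[of "\<lambda>m. G m h" 0 "v * EW * h" d] 1 2 d
      by (auto intro!: G_continuous)
    have uniq: "m' = m" if "m' \<ge> 0" "G m' h = v * EW * h" for m'
      using G_strict_mono[of m m' h] G_strict_mono[of m' m h] that m(1,3) elim(2)
      by linarith
    have "m_plus M W (theta_c M W) h = (THE m. m \<ge> 0 \<and> G m h = v * EW * h)"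
      using elim by (simp add: m_plus_def iff)
    also have "\<dots> = m"
      by (rule the_equality) (use m uniq in blast)+
    finally have eq: "m_plus M W (theta_c M W) h = m" .
    have "m \<noteq> d" "m \<noteq> 0" using m(3) 1 2 by auto
    then show ?case unfolding eq using m by (auto simp: v_def)
  qed
qed

end

section \<open>Tail integrals\<close>

text \<open>Tonelli for f(w) on the region a <= w < X. Truncating from below at \<open>a\<close>
  ensures that only tail probabilities beyond \<open>a\<close> enter.\<close>

lemma (in prob_space) layer_cake:
  fixes X :: "'a \<Rightarrow> real" and F f :: "real \<Rightarrow> real"
  assumes X [measurable]: "X \<in> borel_measurable M"
    and f [measurable]: "f \<in> borel_measurable borel"
    and F: "\<And>x. a \<le> x \<Longrightarrow> (F has_real_derivative f x) (at x)"
    and f_nonneg: "\<And>x. a \<le> x \<Longrightarrow> 0 \<le> f x"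
  shows "(\<integral>\<^sup>+\<omega>. ennreal (F (max a (X \<omega>)) - F a) \<partial>M) =
    (\<integral>\<^sup>+w. ennreal (f w) * indicator {a..} w * ennreal (prob {\<omega> \<in> space M. X \<omega> > w}) \<partial>lborel)"
proof -
  interpret pair_sigma_finite M lborel ..
  let ?k = "\<lambda>\<omega> w. ennreal (f w) * indicator {a..} w * (if w < X \<omega> then 1 else 0)"
  have "ennreal (F (max a (X \<omega>)) - F a) = (\<integral>\<^sup>+w. ?k \<omega> w \<partial>lborel)" for \<omega>
  proof -
    have "ennreal (F (max a (X \<omega>)) - F a) = (\<integral>\<^sup>+w. ennreal (f w) * indicator {a..max a (X \<omega>)} w \<partial>lborel)"
      by (subst nn_integral_FTC_Icc[of f a "max a (X \<omega>)" F]) (auto intro: F f_nonneg)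
    also have "\<dots> = (\<integral>\<^sup>+w. ?k \<omega> w \<partial>lborel)"
    proof (rule nn_integral_cong_AE)
      \<comment> \<open>The two sets differ at most at an endpoint: at X if X >= a, at a
        otherwise.\<close>
      show "AE w in lborel. ennreal (f w) * indicator {a..max a (X \<omega>)} w = ?k \<omega> w"
        using AE_lborel_singleton[of "X \<omega>"] AE_lborel_singleton[of a]
        by eventually_elim (auto simp: indicator_def)
    qed
    finally show ?thesis .
  qed
  then have "(\<integral>\<^sup>+\<omega>. ennreal (F (max a (X \<omega>)) - F a) \<partial>M) = (\<integral>\<^sup>+\<omega>. (\<integral>\<^sup>+w. ?k \<omega> w \<partial>lborel) \<partial>M)"
    by simp
  also have "\<dots> = (\<integral>\<^sup>+w. (\<integral>\<^sup>+\<omega>. ?k \<omega> w \<partial>M) \<partial>lborel)"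
    by (rule Fubini'[symmetric]) measurable
  also have "\<dots> = (\<integral>\<^sup>+w. ennreal (f w) * indicator {a..} w * ennreal (prob {\<omega> \<in> space M. X \<omega> > w}) \<partial>lborel)"
  proof (rule nn_integral_cong)
    fix w
    have "(\<integral>\<^sup>+\<omega>. ?k \<omega> w \<partial>M) = ennreal (f w) * indicator {a..} w * (\<integral>\<^sup>+\<omega>. (if w < X \<omega> then 1 else 0) \<partial>M)"
      by (rule nn_integral_cmult) measurable
    also have "(\<integral>\<^sup>+\<omega>. (if w < X \<omega> then 1 else 0) \<partial>M) = (\<integral>\<^sup>+\<omega>. indicator {\<omega> \<in> space M. X \<omega> > w} \<omega> \<partial>M)"
      by (rule nn_integral_cong) (auto simp: indicator_def)
    also have "\<dots> = ennreal (prob {\<omega> \<in> space M. X \<omega> > w})"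
      by (subst nn_integral_indicator) (auto simp: emeasure_eq_measure)
    finally show "(\<integral>\<^sup>+\<omega>. ?k \<omega> w \<partial>M) =
      ennreal (f w) * indicator {a..} w * ennreal (prob {\<omega> \<in> space M. X \<omega> > w})" .
  qed
  finally show ?thesis .
qed

lemma powr_inverse_base: "x > 0 \<Longrightarrow> (1 / x) powr a = x powr (- a)" for x a :: real
  by (simp add: powr_divide powr_minus_divide)

context weight
begin

lemma K_nn: "ennreal (K m) = (\<integral>\<^sup>+\<omega>. ennreal (min (W \<omega> ^ 6 * m ^ 4) ((W \<omega>)\<^sup>2)) \<partial>M)"
  unfolding K_def
  by (rule nn_integral_eq_integral[OF K_integrable, symmetric]) (auto intro!: AE_I2)

text \<open>The branches of the minimum cross at W = 1/m: below, E[min(W, 1/m)^6] is weighted by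
  m^4, above, the tail of W^2 is integrated. The summand m^4 pays for values below 1.
  \<open>H\<close> stays abstract because the primitive is a power for tau < 7 and a logarithm for
  tau = 7.\<close>

lemma K_upper:
  assumes tail: "\<And>w. w \<ge> 1 \<Longrightarrow> prob {\<omega> \<in> space M. W \<omega> > w} \<le> C * w powr (1 - \<tau>)"
    and C: "C > 0" and \<tau>: "\<tau> > 3" and m: "0 < m" "m < 1"
    and H: "\<And>w. 1 \<le> w \<Longrightarrow> (H has_real_derivative 6 * w ^ 5 * (C * w powr (1 - \<tau>))) (at w)"
  shows "K m \<le> m ^ 4 + m ^ 4 * (H (1 / m) - H 1) + 2 * C / (\<tau> - 3) * m powr (\<tau> - 3)"
proof -
  define b where "b = 1 / m"
  have b: "b > 1" "m = 1 / b" using m by (simp_all add: b_def)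
  define X where "X = (\<lambda>\<omega>. min (W \<omega>) b)"
  have [measurable]: "X \<in> borel_measurable M" unfolding X_def by measurable
  have "(\<integral>\<^sup>+\<omega>. ennreal (max 1 (X \<omega>) ^ 6 - 1 ^ 6) \<partial>M) =
      (\<integral>\<^sup>+w. ennreal (6 * w ^ 5) * indicator {1..} w * ennreal (prob {\<omega> \<in> space M. X \<omega> > w}) \<partial>lborel)"
    by (rule layer_cake[where F = "\<lambda>x. x ^ 6"]) (auto intro!: derivative_eq_intros)
  also have "\<dots> \<le> (\<integral>\<^sup>+w. ennreal (6 * w ^ 5 * (C * w powr (1 - \<tau>))) * indicator {1..b} w \<partial>lborel)"
  proof (rule nn_integral_mono)
    fix w :: real
    consider "w < 1" | "1 \<le> w" "w \<le> b" | "b < w" by linarith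
    then show "ennreal (6 * w ^ 5) * indicator {1..} w * ennreal (prob {\<omega> \<in> space M. X \<omega> > w})
        \<le> ennreal (6 * w ^ 5 * (C * w powr (1 - \<tau>))) * indicator {1..b} w"
    proof cases
      case 2
      have "prob {\<omega> \<in> space M. X \<omega> > w} \<le> prob {\<omega> \<in> space M. W \<omega> > w}"
        by (rule finite_measure_mono) (auto simp: X_def)
      also have "\<dots> \<le> C * w powr (1 - \<tau>)" using tail 2 by simp
      finally have "6 * w ^ 5 * prob {\<omega> \<in> space M. X \<omega> > w} \<le> 6 * w ^ 5 * (C * w powr (1 - \<tau>))"
        using 2 by (intro mult_left_mono) auto
      with 2 show ?thesis by (simp add: ennreal_mult[symmetric] ennreal_leI)
    next
      case 3
      then have "{\<omega> \<in> space M. X \<omega> > w} = {}" by (auto simp: X_def)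
      then have "prob {\<omega> \<in> space M. X \<omega> > w} = 0" by (simp only: measure_empty)
      then show ?thesis by simp
    qed simp
  qed
  also have "\<dots> = ennreal (H b - H 1)"
  proof (rule nn_integral_FTC_Icc)
    show "(\<lambda>w. 6 * w ^ 5 * (C * w powr (1 - \<tau>))) \<in> borel_measurable borel" by measurable
  qed (use b C H in auto)
  finally have I1: "(\<integral>\<^sup>+\<omega>. ennreal (max 1 (X \<omega>) ^ 6 - 1) \<partial>M) \<le> ennreal (H b - H 1)" by simp

  have "(\<integral>\<^sup>+\<omega>. ennreal ((max b (W \<omega>))\<^sup>2 - b\<^sup>2) \<partial>M) =
      (\<integral>\<^sup>+w. ennreal (2 * w) * indicator {b..} w * ennreal (prob {\<omega> \<in> space M. W \<omega> > w}) \<partial>lborel)"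
    by (rule layer_cake[where F = "\<lambda>x. x ^ 2"]) (use b in \<open>auto intro!: derivative_eq_intros\<close>)
  also have "\<dots> \<le> (\<integral>\<^sup>+w. ennreal (2 * C * w powr (2 - \<tau>)) * indicator {b..} w \<partial>lborel)"
  proof (rule nn_integral_mono)
    fix w :: real
    show "ennreal (2 * w) * indicator {b..} w * ennreal (prob {\<omega> \<in> space M. W \<omega> > w})
        \<le> ennreal (2 * C * w powr (2 - \<tau>)) * indicator {b..} w"
    proof (cases "b \<le> w")
      case True
      then have "2 * w * prob {\<omega> \<in> space M. W \<omega> > w} \<le> 2 * w * (C * w powr (1 - \<tau>))"
        using tail b by (intro mult_left_mono) auto
      also have "w * w powr (1 - \<tau>) = w powr (2 - \<tau>)"
        using True b by (simp add: powr_mult_base)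
      then have "2 * w * (C * w powr (1 - \<tau>)) = 2 * C * w powr (2 - \<tau>)"
        by (simp add: mult_ac)
      finally show ?thesis using True b by (simp add: ennreal_mult[symmetric] ennreal_leI)
    qed simp
  qed
  also have "\<dots> = ennreal (0 - (- (2 * C / (\<tau> - 3)) * b powr (3 - \<tau>)))"
  proof (rule nn_integral_FTC_atLeast)
    show "(\<lambda>w. 2 * C * w powr (2 - \<tau>)) \<in> borel_measurable borel" by measurable
    show "((\<lambda>w. - (2 * C / (\<tau> - 3)) * w powr (3 - \<tau>)) \<longlongrightarrow> 0) at_top"
      using \<tau> by real_asymp
    fix w assume w: "b \<le> w"
    have "((\<lambda>w. - (2 * C / (\<tau> - 3)) * w powr (3 - \<tau>)) has_real_derivative
        - (2 * C / (\<tau> - 3)) * ((3 - \<tau>) * w powr (3 - \<tau> - 1))) (at w)"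
      using w b by (intro DERIV_cmult has_real_derivative_powr) auto
    also have "- (2 * C / (\<tau> - 3)) * ((3 - \<tau>) * w powr (3 - \<tau> - 1)) = 2 * C * w powr (2 - \<tau>)"
    proof -
      have "- (2 * C / (\<tau> - 3)) * (3 - \<tau>) = 2 * C" using \<tau> by (simp add: field_simps)
      moreover have "3 - \<tau> - 1 = 2 - \<tau>" by simp
      ultimately show ?thesis by (simp only: mult.assoc[symmetric])
    qed
    finally show "((\<lambda>w. - (2 * C / (\<tau> - 3)) * w powr (3 - \<tau>)) has_real_derivative 2 * C * w powr (2 - \<tau>)) (at w)" .
    show "0 \<le> 2 * C * w powr (2 - \<tau>)" using C by simp
  qed
  finally have I2: "(\<integral>\<^sup>+\<omega>. ennreal ((max b (W \<omega>))\<^sup>2 - b\<^sup>2) \<partial>M) \<le> ennreal (2 * C / (\<tau> - 3) * b powr (3 - \<tau>))"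
    by simp

  have H_mono: "H 1 \<le> H b"
    using b C H by (intro DERIV_nonneg_imp_nondecreasing[of 1 b H]) (auto intro!: exI)
  have "ennreal (K m) \<le> (\<integral>\<^sup>+\<omega>. ennreal (m ^ 4) + (ennreal (m ^ 4) * ennreal (max 1 (X \<omega>) ^ 6 - 1)
      + ennreal ((max b (W \<omega>))\<^sup>2 - b\<^sup>2)) \<partial>M)"
    unfolding K_nn
  proof (rule nn_integral_mono)
    fix \<omega> assume "\<omega> \<in> space M"
    then have W: "W \<omega> > 0" by (rule W_pos)
    have x6: "1 \<le> max 1 (X \<omega>) ^ 6" by (rule one_le_power) simp
    have "min (W \<omega> ^ 6 * m ^ 4) ((W \<omega>)\<^sup>2) \<le> m ^ 4 * X \<omega> ^ 6 + ((max b (W \<omega>))\<^sup>2 - b\<^sup>2)"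
    proof (cases "W \<omega> \<le> b")
      case False
      \<comment> \<open>Beyond b the truncated term is constantly b^2, which the second term
        completes to W^2.\<close>
      have "m ^ 4 * b ^ 6 = b\<^sup>2" using b(1) unfolding b(2) by (simp add: field_simps eval_nat_numeral)
      with False show ?thesis by (simp add: X_def)
    qed (simp add: X_def mult.commute)
    also have "X \<omega> ^ 6 \<le> max 1 (X \<omega>) ^ 6"
      using W b by (intro power_mono) (auto simp: X_def)
    then have "m ^ 4 * X \<omega> ^ 6 + ((max b (W \<omega>))\<^sup>2 - b\<^sup>2) \<le>
        m ^ 4 + (m ^ 4 * (max 1 (X \<omega>) ^ 6 - 1) + ((max b (W \<omega>))\<^sup>2 - b\<^sup>2))"
      using m by (simp add: right_diff_distrib)
    finally have "ennreal (min (W \<omega> ^ 6 * m ^ 4) ((W \<omega>)\<^sup>2)) \<le> \<dots>"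
      by (rule ennreal_leI)
    also have "\<dots> = ennreal (m ^ 4) + (ennreal (m ^ 4) * ennreal (max 1 (X \<omega>) ^ 6 - 1)
      + ennreal ((max b (W \<omega>))\<^sup>2 - b\<^sup>2))"
      using x6 m b by (subst ennreal_plus ennreal_mult; simp)+
    finally show "ennreal (min (W \<omega> ^ 6 * m ^ 4) ((W \<omega>)\<^sup>2)) \<le>
      ennreal (m ^ 4) + (ennreal (m ^ 4) * ennreal (max 1 (X \<omega>) ^ 6 - 1)
      + ennreal ((max b (W \<omega>))\<^sup>2 - b\<^sup>2))" .
  qed
  also have "\<dots> = ennreal (m ^ 4) + (ennreal (m ^ 4) * (\<integral>\<^sup>+\<omega>. ennreal (max 1 (X \<omega>) ^ 6 - 1) \<partial>M)
      + (\<integral>\<^sup>+\<omega>. ennreal ((max b (W \<omega>))\<^sup>2 - b\<^sup>2) \<partial>M))"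
    by (simp add: nn_integral_add nn_integral_cmult emeasure_space_1)
  also have "\<dots> \<le> ennreal (m ^ 4) + (ennreal (m ^ 4) * ennreal (H b - H 1)
      + ennreal (2 * C / (\<tau> - 3) * b powr (3 - \<tau>)))"
    by (intro add_mono mult_left_mono I1 I2) auto
  also have "\<dots> = ennreal (m ^ 4 + (m ^ 4 * (H b - H 1) + 2 * C / (\<tau> - 3) * b powr (3 - \<tau>)))"
    using H_mono C \<tau> m by (subst ennreal_plus ennreal_mult; simp)+
  finally have "K m \<le> m ^ 4 + (m ^ 4 * (H b - H 1) + 2 * C / (\<tau> - 3) * b powr (3 - \<tau>))"
    using H_mono C \<tau> m by (subst (asm) ennreal_le_iff) auto
  moreover have "b powr (3 - \<tau>) = m powr (\<tau> - 3)"
    using powr_inverse_base[of m "3 - \<tau>"] m by (simp add: b_def)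
  ultimately show ?thesis by (simp add: b_def)
qed

text \<open>For tau = 7 the layer-cake integrand is 6 c / w: all scales between \<open>a\<close> and
  1/m contribute equally, and the logarithm is their number.\<close>

lemma K_lower_log:
  assumes tail: "\<And>w. w \<ge> a \<Longrightarrow> c * w powr (-6) \<le> prob {\<omega> \<in> space M. W \<omega> > w}"
    and c: "c > 0" and a: "a > 0" and m: "0 < m" "m < 1 / a"
  shows "6 * c * m ^ 4 * (ln (1 / m) - ln a) \<le> K m"
proof -
  define b where "b = 1 / m"
  have b: "b > a" "m = 1 / b" "b > 0" using m a by (simp_all add: b_def field_simps)
  define X where "X = (\<lambda>\<omega>. min (W \<omega>) b)"
  have [measurable]: "X \<in> borel_measurable M" unfolding X_def by measurable
  have "ennreal (6 * c * ln b - 6 * c * ln a) = (\<integral>\<^sup>+w. ennreal (6 * c / w) * indicator {a..b} w \<partial>lborel)"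
  proof (rule nn_integral_FTC_Icc[symmetric])
    show "((\<lambda>w. 6 * c * ln w) has_real_derivative 6 * c / w) (at w)" if "w \<in> {a..b}" for w
      using that a by (auto intro!: derivative_eq_intros simp: field_simps)
  qed (use a b c in auto)
  also have "\<dots> \<le> (\<integral>\<^sup>+w. ennreal (6 * w ^ 5) * indicator {a..} w * ennreal (prob {\<omega> \<in> space M. X \<omega> > w}) \<partial>lborel)"
  proof (rule nn_integral_mono_AE)
    \<comment> \<open>The point w = b is excluded: there the event X > w is empty and the right side
      vanishes.\<close>
    have "ennreal (6 * c / w) * indicator {a..b} w \<le>
        ennreal (6 * w ^ 5) * indicator {a..} w * ennreal (prob {\<omega> \<in> space M. X \<omega> > w})" if "w \<noteq> b" for w
    proof (cases "a \<le> w \<and> w \<le> b")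
      case True
      then have w: "w > 0" "w < b" "a \<le> w" using a that by auto
      then have "{\<omega> \<in> space M. X \<omega> > w} = {\<omega> \<in> space M. W \<omega> > w}" by (auto simp: X_def)
      then have "6 * w ^ 5 * (c * w powr (-6)) \<le> 6 * w ^ 5 * prob {\<omega> \<in> space M. X \<omega> > w}"
        using tail w by (intro mult_left_mono) auto
      also have "6 * w ^ 5 * (c * w powr (-6)) = 6 * c / w"
        using w by (simp add: powr_minus powr_numeral divide_simps eval_nat_numeral)
      finally show ?thesis
        using w by (simp add: ennreal_mult[symmetric] ennreal_leI)
    qed auto
    then show "AE w in lborel. ennreal (6 * c / w) * indicator {a..b} w \<le>
        ennreal (6 * w ^ 5) * indicator {a..} w * ennreal (prob {\<omega> \<in> space M. X \<omega> > w})"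
      using AE_lborel_singleton[of b] by (auto elim: eventually_mono)
  qed
  also have "\<dots> = (\<integral>\<^sup>+\<omega>. ennreal (max a (X \<omega>) ^ 6 - a ^ 6) \<partial>M)"
    by (rule layer_cake[where F = "\<lambda>x. x ^ 6", symmetric])
       (use a in \<open>auto intro!: derivative_eq_intros\<close>)
  finally have "ennreal (m ^ 4) * ennreal (6 * c * ln b - 6 * c * ln a) \<le>
      ennreal (m ^ 4) * (\<integral>\<^sup>+\<omega>. ennreal (max a (X \<omega>) ^ 6 - a ^ 6) \<partial>M)"
    by (rule mult_left_mono) simp
  also have "\<dots> = (\<integral>\<^sup>+\<omega>. ennreal (m ^ 4) * ennreal (max a (X \<omega>) ^ 6 - a ^ 6) \<partial>M)"
    by (rule nn_integral_cmult[symmetric]) measurable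
  also have "\<dots> \<le> ennreal (K m)"
    unfolding K_nn
  proof (rule nn_integral_mono)
    fix \<omega> assume "\<omega> \<in> space M"
    then have W: "W \<omega> > 0" by (rule W_pos)
    have "m ^ 4 * (max a (X \<omega>) ^ 6 - a ^ 6) \<le> m ^ 4 * X \<omega> ^ 6"
    proof (rule mult_left_mono)
      show "max a (X \<omega>) ^ 6 - a ^ 6 \<le> X \<omega> ^ 6"
        using W a b by (cases "a \<le> X \<omega>") (auto simp: max_def)
    qed (use m in auto)
    also have "\<dots> \<le> min (W \<omega> ^ 6 * m ^ 4) ((W \<omega>)\<^sup>2)"
    proof (rule min.boundedI)
      show "m ^ 4 * X \<omega> ^ 6 \<le> W \<omega> ^ 6 * m ^ 4"
        using W b m by (subst mult.commute, intro mult_right_mono power_mono) (auto simp: X_def)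
      have X: "X \<omega> > 0" "X \<omega> \<le> b" "X \<omega> \<le> W \<omega>" using W b by (auto simp: X_def)
      have "m ^ 4 * X \<omega> ^ 6 = (m * X \<omega>) ^ 4 * (X \<omega>)\<^sup>2"
        by (simp add: power_mult_distrib eval_nat_numeral mult_ac)
      also have "\<dots> \<le> 1 * (W \<omega>)\<^sup>2"
      proof (intro mult_mono power_le_one power_mono)
        have "m * X \<omega> \<le> m * b" using X m by (intro mult_left_mono) auto
        then show "m * X \<omega> \<le> 1" using b by simp
      qed (use X m in auto)
      finally show "m ^ 4 * X \<omega> ^ 6 \<le> (W \<omega>)\<^sup>2" by simp
    qed
    finally show "ennreal (m ^ 4) * ennreal (max a (X \<omega>) ^ 6 - a ^ 6) \<le> ennreal (min (W \<omega> ^ 6 * m ^ 4) ((W \<omega>)\<^sup>2))"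
      using a m by (subst ennreal_mult[symmetric]) (auto intro!: ennreal_leI power_mono)
  qed
  finally have "ennreal (m ^ 4 * (6 * c * ln b - 6 * c * ln a)) \<le> ennreal (K m)"
    using m by (subst ennreal_mult') auto
  moreover have "K m \<ge> 0" using K_pos[of m] m by simp
  ultimately have "m ^ 4 * (6 * c * ln b - 6 * c * ln a) \<le> K m"
    by (simp add: ennreal_le_iff)
  then show ?thesis by (simp add: b_def algebra_simps)
qed

text \<open>Beyond 1/m the integrand is at least 1/m^2. For 3 < tau < 7 this range alone has the
  full order m^(tau-3); for tau = 7 it would miss the logarithm.\<close>

lemma K_lower_tail:
  assumes "m > 0"
  shows "prob {\<omega> \<in> space M. W \<omega> > 1 / m} / m\<^sup>2 \<le> K m"
proof -
  have "prob {\<omega> \<in> space M. W \<omega> > 1 / m} / m\<^sup>2 =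
      expectation (\<lambda>\<omega>. indicator {\<omega> \<in> space M. W \<omega> > 1 / m} \<omega> * (1 / m\<^sup>2))"
    by simp
  also have "\<dots> \<le> K m"
    unfolding K_def
  proof (intro integral_mono K_integrable)
    show "integrable M (\<lambda>\<omega>. indicator {\<omega> \<in> space M. W \<omega> > 1 / m} \<omega> * (1 / m\<^sup>2))"
      by (intro integrable_mult_left integrable_real_indicator) (auto simp: less_top[symmetric])
    fix \<omega> assume "\<omega> \<in> space M"
    show "indicator {\<omega> \<in> space M. W \<omega> > 1 / m} \<omega> * (1 / m\<^sup>2) \<le> min (W \<omega> ^ 6 * m ^ 4) ((W \<omega>)\<^sup>2)"
    proof (cases "W \<omega> > 1 / m")
      case True
      have "(1 / m)\<^sup>2 \<le> (W \<omega>)\<^sup>2" "(1 / m) ^ 6 * m ^ 4 \<le> W \<omega> ^ 6 * m ^ 4"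
        using less_imp_le[OF True] assms by (auto intro!: power_mono mult_right_mono)
      moreover have "(1 / m) ^ 6 * m ^ 4 = 1 / m\<^sup>2" using assms by (simp add: field_simps eval_nat_numeral)
      ultimately show ?thesis using True by (simp add: power_one_over indicator_def)
    qed (auto simp: indicator_def)
  qed
  finally show ?thesis .
qed

end

section \<open>Asymptotics near criticality\<close>

lemma bigtheta_two_sided:
  fixes f g :: "'b \<Rightarrow> real"
  assumes "f \<in> \<Theta>[F](g)" "eventually (\<lambda>x. f x \<ge> 0) F" "eventually (\<lambda>x. g x \<ge> 0) F"
  obtains c C where "c > 0" "C > 0" "eventually (\<lambda>x. c * g x \<le> f x \<and> f x \<le> C * g x) F"
proof -
  obtain C where C: "C > 0" "eventually (\<lambda>x. norm (f x) \<le> C * norm (g x)) F"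
    using bigthetaD1[OF assms(1)] by (elim landau_o.bigE)
  obtain c where c: "c > 0" "eventually (\<lambda>x. norm (f x) \<ge> c * norm (g x)) F"
    using bigthetaD2[OF assms(1)] by (elim landau_omega.bigE)
  have "eventually (\<lambda>x. c * g x \<le> f x \<and> f x \<le> C * g x) F"
    using C(2) c(2) assms(2,3) by eventually_elim auto
  with c C that show thesis by blast
qed

lemma bigtheta_inverse_powr:
  fixes m f :: "'b \<Rightarrow> real"
  assumes m: "filterlim m (at_right 0) F" and p: "p > 0"
    and \<Theta>: "(\<lambda>x. m x powr p) \<in> \<Theta>[F](f)" and f: "eventually (\<lambda>x. f x \<ge> 0) F"
  shows "m \<in> \<Theta>[F](\<lambda>x. f x powr (1 / p))"
proof -
  have "eventually (\<lambda>x. m x > 0) F"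
    using m by (simp add: filterlim_at)  (auto elim: eventually_mono)
  then have "m \<in> \<Theta>[F](\<lambda>x. \<bar>m x powr p\<bar> powr (1 / p))"
    by (intro bigthetaI_cong, eventually_elim) (use p in \<open>simp add: powr_powr\<close>)
  also have "(\<lambda>x. \<bar>m x powr p\<bar> powr (1 / p)) \<in> \<Theta>[F](\<lambda>x. \<bar>f x\<bar> powr (1 / p))"
    by (rule bigtheta_powr[OF \<Theta>])
  also have "(\<lambda>x. \<bar>f x\<bar> powr (1 / p)) \<in> \<Theta>[F](\<lambda>x. f x powr (1 / p))"
    by (intro bigthetaI_cong eventually_mono[OF f]) simp
  finally show ?thesis .
qed

text \<open>Taking logarithms, ln(1/f) = p ln(1/m) - ln ln(1/m) + O(1), so ln(1/f) and ln(1/m) have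
  the same order and one may replace the other.\<close>

lemma bigtheta_inverse_powr_log:
  fixes m f :: "'b \<Rightarrow> real"
  assumes m: "filterlim m (at_right 0) F" and p: "p > 0"
    and \<Theta>: "(\<lambda>x. m x powr p * ln (1 / m x)) \<in> \<Theta>[F](f)" and f: "eventually (\<lambda>x. f x > 0) F"
  shows "m \<in> \<Theta>[F](\<lambda>x. (f x / ln (1 / f x)) powr (1 / p))"
proof -
  define l where "l = (\<lambda>x. ln (1 / m x))"
  have mpos: "eventually (\<lambda>x. m x > 0) F"
    using m by (simp add: filterlim_at) (auto elim: eventually_mono)
  have "filterlim (\<lambda>y::real. ln (1 / y)) at_top (at_right 0)" by real_asymp
  from filterlim_compose[OF this m] have l: "filterlim l at_top F" by (simp add: l_def)
  have lpos: "eventually (\<lambda>x. l x > 0) F"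
    using l by (simp add: filterlim_at_top_dense)
  have "eventually (\<lambda>x. f x \<ge> 0) F" using f by eventually_elim simp
  moreover have "eventually (\<lambda>x. m x powr p * ln (1 / m x) \<ge> 0) F"
    using lpos by eventually_elim (simp add: l_def)
  ultimately obtain c C where cC: "c > 0" "C > 0"
    "eventually (\<lambda>x. c * f x \<le> m x powr p * ln (1 / m x) \<and> m x powr p * ln (1 / m x) \<le> C * f x) F"
    using bigtheta_two_sided[OF \<Theta>] by blast
  \<comment> \<open>The factors 1/2 here and 2 below leave room around p y for ln y and the
    constant.\<close>
  have "eventually (\<lambda>y. p / 2 * y \<le> p * y - ln y + ln c) at_top"
    using p cC by real_asymp
  then have e1: "eventually (\<lambda>x. p / 2 * l x \<le> p * l x - ln (l x) + ln c) F"
    using l by (rule eventually_compose_filterlim)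
  have "eventually (\<lambda>y. p * y - ln y + ln C \<le> 2 * p * y) at_top"
    using p cC by real_asymp
  then have e2: "eventually (\<lambda>x. p * l x - ln (l x) + ln C \<le> 2 * p * l x) F"
    using l by (rule eventually_compose_filterlim)
  have "eventually (\<lambda>x. p * c / 2 * (f x / ln (1 / f x)) \<le> m x powr p \<and>
      m x powr p \<le> 2 * p * C * (f x / ln (1 / f x)) \<and> f x / ln (1 / f x) > 0) F"
    using mpos lpos f cC(3) e1 e2
  proof eventually_elim
    case (elim x)
    define a where "a = m x powr p * l x"
    have a: "a > 0" "c * f x \<le> a" "a \<le> C * f x" using elim by (auto simp: a_def l_def)
    have lna: "ln a = - (p * l x - ln (l x))"
    proof -
      have "ln a = ln (m x powr p) + ln (l x)"
        unfolding a_def using elim by (intro ln_mult_pos) auto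
      moreover have "l x = - ln (m x)" using elim by (simp add: l_def ln_div)
      ultimately show ?thesis using elim by (simp add: ln_powr)
    qed
    have "ln (c * f x) \<le> ln a" "ln a \<le> ln (C * f x)"
      using a elim cC by (auto intro!: ln_mono mult_pos_pos)
    then have "p * l x - ln (l x) + ln c \<le> - ln (f x)" "- ln (f x) \<le> p * l x - ln (l x) + ln C"
      using elim cC by (simp_all add: ln_mult lna)
    then have L: "p / 2 * l x \<le> ln (1 / f x)" "ln (1 / f x) \<le> 2 * p * l x"
      using elim by (simp_all add: ln_div)
    have Lpos: "ln (1 / f x) > 0" using L(1) elim p by (smt (verit) divide_pos_pos mult_pos_pos)
    have "p * c / 2 * f x = p / 2 * (c * f x)" by simp
    also have "\<dots> \<le> p / 2 * a" using a p by (intro mult_left_mono) auto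
    also have "\<dots> = m x powr p * (p / 2 * l x)" by (simp add: a_def)
    also have "\<dots> \<le> m x powr p * ln (1 / f x)" using L by (intro mult_left_mono) auto
    finally have 1: "p * c / 2 * (f x / ln (1 / f x)) \<le> m x powr p"
      using Lpos by (simp add: field_simps)
    have "m x powr p * ln (1 / f x) \<le> m x powr p * (2 * p * l x)"
      using L by (intro mult_left_mono) auto
    also have "\<dots> = 2 * p * a" by (simp add: a_def)
    also have "\<dots> \<le> 2 * p * (C * f x)" using a p by (intro mult_left_mono) auto
    finally have 2: "m x powr p \<le> 2 * p * C * (f x / ln (1 / f x))"
      using Lpos by (simp add: field_simps)
    show ?case using 1 2 Lpos elim by auto
  qed
  then have ev: "eventually (\<lambda>x. p * c / 2 * (f x / ln (1 / f x)) \<le> m x powr p) F"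
    "eventually (\<lambda>x. m x powr p \<le> 2 * p * C * (f x / ln (1 / f x))) F"
    "eventually (\<lambda>x. f x / ln (1 / f x) > 0) F"
    by (auto elim: eventually_mono)
  have "(\<lambda>x. m x powr p) \<in> \<Theta>[F](\<lambda>x. f x / ln (1 / f x))"
  proof (rule bigthetaI'[of "p * c / 2" "2 * p * C"])
    show "\<forall>\<^sub>F x in F. p * c / 2 * norm (f x / ln (1 / f x)) \<le> norm (m x powr p) \<and>
        norm (m x powr p) \<le> 2 * p * C * norm (f x / ln (1 / f x))"
      using ev
      by eventually_elim (simp only: real_norm_def abs_of_pos abs_of_nonneg powr_ge_zero)
  qed (use p cC in auto)
  then show ?thesis
    by (rule bigtheta_inverse_powr[OF m p]) (use ev(3) in \<open>auto elim: eventually_mono\<close>)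
qed

section \<open>The order of K at zero\<close>

context weight
begin

text \<open>Up to w0 probabilities are at most 1 <= w0^(tau-1) w^(1-tau), so a larger constant
  extends the bound down to 1.\<close>

lemma power_law_tail:
  assumes "power_law M W \<tau>" "\<tau> > 1"
  obtains C where "C > 0" "\<And>w. w \<ge> 1 \<Longrightarrow> prob {\<omega> \<in> space M. W \<omega> > w} \<le> C * w powr (1 - \<tau>)"
proof -
  obtain c C w0 where C: "0 < c" "c < C" "1 < w0"
    "\<And>w. w > w0 \<Longrightarrow> prob {\<omega> \<in> space M. W \<omega> > w} \<le> C * w powr (-(\<tau> - 1))"
    using assms(1) unfolding power_law_def by blast
  have "prob {\<omega> \<in> space M. W \<omega> > w} \<le> max C (w0 powr (\<tau> - 1)) * w powr (1 - \<tau>)" if "w \<ge> 1" for w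
  proof (cases "w > w0")
    case True
    then have "prob {\<omega> \<in> space M. W \<omega> > w} \<le> C * w powr (1 - \<tau>)" using C(4) by simp
    also have "\<dots> \<le> max C (w0 powr (\<tau> - 1)) * w powr (1 - \<tau>)" by (intro mult_right_mono) auto
    finally show ?thesis .
  next
    case False
    have "prob {\<omega> \<in> space M. W \<omega> > w} \<le> 1" by simp
    also have "1 = w powr (\<tau> - 1) * w powr (1 - \<tau>)" using that by (simp flip: powr_add)
    also have "\<dots> \<le> max C (w0 powr (\<tau> - 1)) * w powr (1 - \<tau>)"
      using False that assms(2) by (intro mult_right_mono) (auto intro!: powr_mono2 simp: le_max_iff_disj)
    finally show ?thesis .
  qed
  moreover have "max C (w0 powr (\<tau> - 1)) > 0" using C by (simp add: less_max_iff_disj)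
  ultimately show thesis using that by blast
qed

lemma K_bigthetaI:
  assumes "c > 0" "C > 0" "\<forall>\<^sub>F m in at_right 0. g m \<ge> 0"
    "\<forall>\<^sub>F m in at_right 0. c * g m \<le> K m" "\<forall>\<^sub>F m in at_right 0. K m \<le> C * g m"
  shows "K \<in> \<Theta>[at_right 0](g)"
proof (rule bigthetaI'[OF assms(1,2)])
  have "\<forall>\<^sub>F m::real in at_right 0. m > 0" by (auto simp: eventually_at_filter)
  with assms(3-5) show "\<forall>\<^sub>F m in at_right 0. c * norm (g m) \<le> norm (K m) \<and> norm (K m) \<le> C * norm (g m)"
    by eventually_elim (use K_pos in \<open>auto simp: less_imp_le abs_of_pos\<close>)
qed

text \<open>The upper bound takes the first branch of the minimum. For the lower one, m^4 < 1 scales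
  the first branch of the integrand of \<open>K 1\<close> exactly and only decreases the
  second.\<close>

lemma K_bigtheta_moment:
  assumes "integrable M (\<lambda>\<omega>. W \<omega> ^ 6)"
  shows "K \<in> \<Theta>[at_right 0](\<lambda>m. m powr 4)"
proof (rule K_bigthetaI)
  show "K 1 > 0" by (simp add: K_pos)
  show "expectation (\<lambda>\<omega>. W \<omega> ^ 6) > 0"
    using W_pos by (intro expectation_pos assms zero_less_power)
  have ev: "\<forall>\<^sub>F m::real in at_right 0. 0 < m \<and> m < 1"
    using eventually_at_right_real[of 0 "1::real"] by simp
  show "\<forall>\<^sub>F m in at_right 0. K 1 * m powr 4 \<le> K m"
    using ev
  proof eventually_elim
    case (elim m)
    have "K 1 * m ^ 4 = expectation (\<lambda>\<omega>. min (W \<omega> ^ 6 * 1 ^ 4) ((W \<omega>)\<^sup>2) * m ^ 4)"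
      by (simp add: K_def)
    also have "\<dots> \<le> K m"
      unfolding K_def
    proof (intro integral_mono integrable_mult_left K_integrable)
      fix \<omega>
      have "min (W \<omega> ^ 6 * 1 ^ 4) ((W \<omega>)\<^sup>2) * m ^ 4 = min (W \<omega> ^ 6 * m ^ 4) ((W \<omega>)\<^sup>2 * m ^ 4)"
        using elim by (simp add: min_mult_distrib_right)
      also have "\<dots> \<le> min (W \<omega> ^ 6 * m ^ 4) ((W \<omega>)\<^sup>2)"
        using elim by (intro min.mono) (auto intro!: mult_left_le power_le_one)
      finally show "min (W \<omega> ^ 6 * 1 ^ 4) ((W \<omega>)\<^sup>2) * m ^ 4 \<le> min (W \<omega> ^ 6 * m ^ 4) ((W \<omega>)\<^sup>2)" .
    qed
    finally show ?case using elim by (simp add: powr_numeral)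
  qed
  show "\<forall>\<^sub>F m in at_right 0. K m \<le> expectation (\<lambda>\<omega>. W \<omega> ^ 6) * m powr 4"
    using ev
  proof eventually_elim
    case (elim m)
    have "K m \<le> expectation (\<lambda>\<omega>. W \<omega> ^ 6 * m ^ 4)"
      unfolding K_def using assms by (intro integral_mono K_integrable) auto
    then show ?case using elim by (simp add: powr_numeral)
  qed
qed simp

lemma K_bigtheta_power_law:
  assumes "power_law M W \<tau>" "3 < \<tau>" "\<tau> < 7"
  shows "K \<in> \<Theta>[at_right 0](\<lambda>m. m powr (\<tau> - 3))"
proof -
  obtain C where C: "C > 0" "\<And>w. w \<ge> 1 \<Longrightarrow> prob {\<omega> \<in> space M. W \<omega> > w} \<le> C * w powr (1 - \<tau>)"
    using power_law_tail[OF assms(1)] assms by auto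
  obtain c w0 where c: "0 < c" "1 < w0"
    "\<And>w. w > w0 \<Longrightarrow> c * w powr (-(\<tau> - 1)) \<le> prob {\<omega> \<in> space M. W \<omega> > w}"
    using assms(1) unfolding power_law_def by blast
  define H where "H = (\<lambda>w::real. 6 * C / (7 - \<tau>) * w powr (7 - \<tau>))"
  have H: "(H has_real_derivative 6 * w ^ 5 * (C * w powr (1 - \<tau>))) (at w)" if "w \<ge> 1" for w
  proof -
    have "(H has_real_derivative 6 * C / (7 - \<tau>) * ((7 - \<tau>) * w powr (7 - \<tau> - 1))) (at w)"
      unfolding H_def using that by (intro DERIV_cmult has_real_derivative_powr) auto
    also have "6 * C / (7 - \<tau>) * ((7 - \<tau>) * w powr (7 - \<tau> - 1)) = 6 * C * w powr (5 + (1 - \<tau>))"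
      using assms by simp
    also have "\<dots> = 6 * w ^ 5 * (C * w powr (1 - \<tau>))"
      unfolding powr_add using that by (simp add: powr_numeral)
    finally show ?thesis .
  qed
  \<comment> \<open>One constant for each summand of \<open>K_upper\<close>; the first uses m^4 <=
    m^(tau-3), valid for m < 1 and tau < 7.\<close>
  define D where "D = 1 + 6 * C / (7 - \<tau>) + 2 * C / (\<tau> - 3)"
  have ev: "\<forall>\<^sub>F m::real in at_right 0. 0 < m \<and> m < 1 / w0"
    using eventually_at_right_real[of 0 "1 / w0"] c by simp
  show ?thesis
  proof (rule K_bigthetaI)
    show "c > 0" by fact
    show "D > 0" unfolding D_def using C assms by (intro add_pos_pos) auto
    show "\<forall>\<^sub>F m in at_right 0. c * m powr (\<tau> - 3) \<le> K m"
      using ev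
    proof eventually_elim
      case (elim m)
      have "1 / m > w0" using elim c by (simp add: field_simps)
      then have "c * (1 / m) powr (-(\<tau> - 1)) / m\<^sup>2 \<le> prob {\<omega> \<in> space M. W \<omega> > 1 / m} / m\<^sup>2"
        by (intro divide_right_mono c) auto
      also have "\<dots> \<le> K m" using elim by (intro K_lower_tail) auto
      also have "(1 / m) powr (-(\<tau> - 1)) / m\<^sup>2 = m powr (\<tau> - 3)"
      proof -
        have "(1 / m) powr (-(\<tau> - 1)) = m powr (\<tau> - 3 + 2)"
          using powr_inverse_base[of m "-(\<tau> - 1)"] elim by simp
        also have "\<dots> = m powr (\<tau> - 3) * m powr 2" by (rule powr_add)
        also have "m powr 2 = m\<^sup>2" using elim by (simp add: powr_numeral)
        finally show ?thesis using elim by simp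
      qed
      then have "c * (1 / m) powr (-(\<tau> - 1)) / m\<^sup>2 = c * m powr (\<tau> - 3)"
        by (simp only: times_divide_eq_right[symmetric])
      finally show ?case .
    qed
    show "\<forall>\<^sub>F m in at_right 0. K m \<le> D * m powr (\<tau> - 3)"
      using ev
    proof eventually_elim
      case (elim m)
      have "1 / w0 < 1" using c by simp
      then have m: "0 < m" "m < 1" using elim by linarith+
      have p4: "m ^ 4 = m powr 4" using m by (simp add: powr_numeral)
      have "K m \<le> m ^ 4 + m ^ 4 * (H (1 / m) - H 1) + 2 * C / (\<tau> - 3) * m powr (\<tau> - 3)"
        using K_upper[OF C(2,1) assms(2) m H] .
      moreover have "m ^ 4 \<le> m powr (\<tau> - 3)"
        unfolding p4 using m assms by (intro powr_mono') auto
      moreover have "m ^ 4 * (H (1 / m) - H 1) \<le> m ^ 4 * H (1 / m)"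
        using m C assms by (intro mult_left_mono) (auto simp: H_def)
      moreover have "m ^ 4 * H (1 / m) = 6 * C / (7 - \<tau>) * m powr (\<tau> - 3)"
      proof -
        have "(1 / m) powr (7 - \<tau>) = m powr (\<tau> - 7)"
          using powr_inverse_base[of m "7 - \<tau>"] m by simp
        moreover have "m powr 4 * m powr (\<tau> - 7) = m powr (\<tau> - 3)" by (simp flip: powr_add)
        ultimately show ?thesis by (simp add: H_def p4)
      qed
      moreover have "D * m powr (\<tau> - 3) = m powr (\<tau> - 3) + 6 * C / (7 - \<tau>) * m powr (\<tau> - 3)
          + 2 * C / (\<tau> - 3) * m powr (\<tau> - 3)"
        by (simp add: D_def distrib_right)
      ultimately show ?case by linarith
    qed
  qed simp
qed

lemma K_bigtheta_power_law_log:
  assumes "power_law M W 7"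
  shows "K \<in> \<Theta>[at_right 0](\<lambda>m. m powr 4 * ln (1 / m))"
proof -
  obtain C where C: "C > 0" "\<And>w. w \<ge> 1 \<Longrightarrow> prob {\<omega> \<in> space M. W \<omega> > w} \<le> C * w powr (1 - 7)"
    using power_law_tail[OF assms(1)] by auto
  obtain c w0 where c: "0 < c" "1 < w0"
    "\<And>w. w > w0 \<Longrightarrow> c * w powr (-(7 - 1)) \<le> prob {\<omega> \<in> space M. W \<omega> > w}"
    using assms(1) unfolding power_law_def by blast
  \<comment> \<open>A point beyond \<open>w0\<close> turns the strict range of the power law into
    the closed one of \<open>K_lower_log\<close>.\<close>
  define a where "a = w0 + 1"
  have a: "c * w powr (-6) \<le> prob {\<omega> \<in> space M. W \<omega> > w}" if "w \<ge> a" for w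
    using c(3)[of w] that by (simp add: a_def)
  have a1: "a > 1" using c by (simp add: a_def)
  define H where "H = (\<lambda>w::real. 6 * C * ln w)"
  have H: "(H has_real_derivative 6 * w ^ 5 * (C * w powr (1 - 7))) (at w)" if "w \<ge> 1" for w
  proof -
    have "(H has_real_derivative 6 * C * (1 / w)) (at w)"
      unfolding H_def using that by (intro DERIV_cmult DERIV_ln_divide) auto
    also have "6 * C * (1 / w) = 6 * w ^ 5 * (C * w powr (1 - 7))"
      using that by (simp add: powr_minus powr_numeral divide_simps eval_nat_numeral)
    finally show ?thesis .
  qed
  have ev: "\<forall>\<^sub>F m::real in at_right 0. 0 < m \<and> m < 1 / a"
    using eventually_at_right_real[of 0 "1 / a"] a1 by simp
  \<comment> \<open>This makes ln(1/m) - ln a at least half of ln(1/m), and ln(1/m) at least 1, so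
    that the pure m^4 terms are absorbed.\<close>
  have "\<forall>\<^sub>F m::real in at_right 0. 1 + 2 * ln a < ln (1 / m)" by real_asymp
  with ev have ev: "\<forall>\<^sub>F m::real in at_right 0. 0 < m \<and> m < 1 / a \<and> 1 + 2 * ln a < ln (1 / m)"
    by eventually_elim simp
  define D where "D = 1 + 6 * C + C / 2"
  have lna: "ln a > 0" using a1 by simp
  show ?thesis
  proof (rule K_bigthetaI)
    show "3 * c > 0" using c by simp
    show "D > 0" unfolding D_def using C by simp
    show "\<forall>\<^sub>F m::real in at_right 0. m powr 4 * ln (1 / m) \<ge> 0"
      using ev
    proof eventually_elim
      case (elim m)
      then have "ln (1 / m) \<ge> 0" using lna by linarith
      then show ?case by (intro mult_nonneg_nonneg) auto
    qed
    show "\<forall>\<^sub>F m in at_right 0. 3 * c * (m powr 4 * ln (1 / m)) \<le> K m"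
      using ev
    proof eventually_elim
      case (elim m)
      have "3 * c * (m powr 4 * ln (1 / m)) = 6 * c * m ^ 4 * (ln (1 / m) / 2)"
        using elim by (simp add: powr_numeral)
      also have "\<dots> \<le> 6 * c * m ^ 4 * (ln (1 / m) - ln a)"
        using elim c by (intro mult_left_mono) auto
      also have "\<dots> \<le> K m"
        using elim a c(1) a1 by (intro K_lower_log) auto
      finally show ?case .
    qed
    show "\<forall>\<^sub>F m in at_right 0. K m \<le> D * (m powr 4 * ln (1 / m))"
      using ev
    proof eventually_elim
      case (elim m)
      have "1 / a < 1" using a1 by simp
      then have m: "0 < m" "m < 1" using elim by linarith+
      have p4: "m powr 4 = m ^ 4" using m by (simp add: powr_numeral)
      have "ln (1 / m) \<ge> 1" using elim lna by linarith
      then have l: "m ^ 4 * 1 \<le> m ^ 4 * ln (1 / m)" using m by (intro mult_left_mono) auto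
      have "K m \<le> m ^ 4 + m ^ 4 * (H (1 / m) - H 1) + 2 * C / (7 - 3) * m powr (7 - 3)"
        using K_upper[OF C(2,1) _ m H] by simp
      also have "\<dots> = (1 + C / 2) * m ^ 4 + 6 * C * (m ^ 4 * ln (1 / m))"
        by (simp add: H_def p4 algebra_simps)
      also have "\<dots> \<le> (1 + C / 2) * (m ^ 4 * ln (1 / m)) + 6 * C * (m ^ 4 * ln (1 / m))"
        using l C by (intro add_right_mono mult_left_mono) auto
      finally show ?case by (simp add: D_def p4 algebra_simps)
    qed
  qed
qed

lemma K_tendsto_0:
  assumes "K \<in> \<Theta>[at_right 0](k)" "(k \<longlongrightarrow> 0) (at_right 0)"
  shows "(K \<longlongrightarrow> 0) (at_right 0)"
proof -
  obtain C where C: "C > 0" "\<forall>\<^sub>F m in at_right 0. norm (K m) \<le> C * norm (k m)"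
    using bigthetaD1[OF assms(1)] by (elim landau_o.bigE)
  have "((\<lambda>m. C * norm (k m)) \<longlongrightarrow> C * norm (0::real)) (at_right 0)"
    by (intro tendsto_intros assms)
  then show ?thesis
    by (intro Lim_null_comparison[OF C(2)]) simp
qed

section \<open>From K to the magnetisation\<close>

lemma m_plus_zero_field_tendsto:
  assumes "(K \<longlongrightarrow> 0) (at_right 0)"
  shows "filterlim (\<lambda>\<theta>. m_plus M W \<theta> 0) (at_right 0) (at_right (theta_c M W))"
  unfolding filterlim_at
proof
  show "\<forall>\<^sub>F \<theta> in at_right (theta_c M W). m_plus M W \<theta> 0 \<in> {0<..} \<and> m_plus M W \<theta> 0 \<noteq> 0"
    using m_plus_zero_field[OF assms zero_less_one] by eventually_elim auto
  show "((\<lambda>\<theta>. m_plus M W \<theta> 0) \<longlongrightarrow> 0) (at_right (theta_c M W))"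
  proof (rule tendstoI)
    fix e :: real assume "e > 0"
    from m_plus_zero_field[OF assms this]
    show "\<forall>\<^sub>F \<theta> in at_right (theta_c M W). dist (m_plus M W \<theta> 0) 0 < e"
      by eventually_elim (simp add: dist_real_def)
  qed
qed

lemma m_plus_critical_tendsto:
  "filterlim (\<lambda>h. m_plus M W (theta_c M W) h) (at_right 0) (at_right 0)"
  unfolding filterlim_at
proof
  show "\<forall>\<^sub>F h in at_right 0. m_plus M W (theta_c M W) h \<in> {0<..} \<and> m_plus M W (theta_c M W) h \<noteq> 0"
    using m_plus_critical[OF zero_less_one] by eventually_elim auto
  show "((\<lambda>h. m_plus M W (theta_c M W) h) \<longlongrightarrow> 0) (at_right 0)"
  proof (rule tendstoI)
    fix e :: real assume "e > 0"
    from m_plus_critical[OF this]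
    show "\<forall>\<^sub>F h in at_right 0. dist (m_plus M W (theta_c M W) h) 0 < e"
      by eventually_elim (simp add: dist_real_def)
  qed
qed

lemma K_m_plus_zero_field:
  assumes "(K \<longlongrightarrow> 0) (at_right 0)"
  shows "(\<lambda>\<theta>. K (m_plus M W \<theta> 0)) \<in> \<Theta>[at_right (theta_c M W)](\<lambda>\<theta>. \<theta> - theta_c M W)"
proof -
  define tc where "tc = theta_c M W"
  have tc: "tc > 0" using theta_c_pos by (simp add: tc_def)
  obtain A B where AB: "A > 0" "B > 0" "\<And>m. m > 0 \<Longrightarrow> A * (m * K m) \<le> G m 0"
     "\<And>m. m > 0 \<Longrightarrow> G m 0 \<le> B * (m * K m)" using G_bounds by blast
  \<comment> \<open>The slope of \<open>EW\<close> (1/tc - 1/theta) at theta = tc.\<close>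
  define r where "r = EW / tc\<^sup>2"
  have r: "r > 0" using EW_pos tc by (simp add: r_def)
  \<comment> \<open>Below 2 tc the factor tc / theta stays above 1/2, which makes the coefficient
    comparable to r (theta - tc).\<close>
  have ev: "\<forall>\<^sub>F \<theta> in at_right tc. tc < \<theta> \<and> \<theta> < 2 * tc"
    using eventually_at_right_real[of tc "2 * tc"] tc by simp
  have "\<forall>\<^sub>F \<theta> in at_right tc. r / 2 / B * (\<theta> - tc) \<le> K (m_plus M W \<theta> 0) \<and>
      K (m_plus M W \<theta> 0) \<le> r / A * (\<theta> - tc)"
    using m_plus_zero_field[OF assms zero_less_one, folded tc_def] ev
  proof eventually_elim
    case (elim \<theta>)
    define m where "m = m_plus M W \<theta> 0"
    define e where "e = EW * (1 / tc - 1 / \<theta>)"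
    have th: "\<theta> > 0" using elim tc by simp
    have m: "m > 0" "G m 0 = m * e" using elim by (simp_all add: m_def e_def mult_ac)
    have "A * K m \<le> e" "e \<le> B * K m"
      using AB(3,4)[OF m(1)] m by (simp_all add: mult.left_commute[of _ m])
    moreover have eq: "e = r * (\<theta> - tc) * (tc / \<theta>)"
      using tc th by (simp add: e_def r_def field_simps power2_eq_square)
    have "r * (\<theta> - tc) * (1 / 2) \<le> e" "e \<le> r * (\<theta> - tc) * 1"
      unfolding eq using elim r th tc by (intro mult_left_mono; simp add: field_simps)+
    ultimately have "r / 2 * (\<theta> - tc) \<le> B * K m" "A * K m \<le> r * (\<theta> - tc)" by linarith+
    then show ?case using AB by (simp add: m_def[symmetric] field_simps)
  qed
  then have "\<forall>\<^sub>F \<theta> in at_right tc. r / 2 / B * norm (\<theta> - tc) \<le> norm (K (m_plus M W \<theta> 0)) \<and>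
      norm (K (m_plus M W \<theta> 0)) \<le> r / A * norm (\<theta> - tc)"
    using m_plus_zero_field[OF assms zero_less_one, folded tc_def] ev
    by eventually_elim (use K_pos in \<open>auto simp: abs_of_pos\<close>)
  then show ?thesis
    unfolding tc_def[symmetric] using r AB by (intro bigthetaI'[of "r / 2 / B" "r / A"]) auto
qed

text \<open>Absorbs the doubled argument produced by \<open>G_split\<close>; 16 is 2^4 from the
  first branch.\<close>

lemma K_doubling: "K (2 * m) \<le> 16 * K m"
proof -
  have "K (2 * m) \<le> expectation (\<lambda>\<omega>. 16 * min (W \<omega> ^ 6 * m ^ 4) ((W \<omega>)\<^sup>2))"
    unfolding K_def
  proof (intro integral_mono integrable_mult_right K_integrable)
    fix \<omega>
    show "min (W \<omega> ^ 6 * (2 * m) ^ 4) ((W \<omega>)\<^sup>2) \<le> 16 * min (W \<omega> ^ 6 * m ^ 4) ((W \<omega>)\<^sup>2)"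
    proof -
      have "min (16 * a) b \<le> 16 * min a b" if "0 \<le> a" "0 \<le> b" for a b :: real
        using that by (auto simp: min_def)
      from this[of "W \<omega> ^ 6 * m ^ 4" "(W \<omega>)\<^sup>2"] show ?thesis
        by (simp add: power_mult_distrib mult_ac)
    qed
  qed
  then show ?thesis by (simp add: K_def)
qed

text \<open>Since \<open>\<rho>\<close> is increasing, \<open>\<rho>(a + b) \<le> \<rho>(2a) + \<rho>(2b)\<close>.\<close>

lemma G_split:
  assumes "m \<ge> 0" "h \<ge> 0"
  shows "G m h \<le> G (2 * m) 0 + EW * rho (2 * h)"
proof -
  have mono: "rho s \<le> rho t" if "0 \<le> s" "s \<le> t" for s t
    using that rho_strict_mono[of s t] by (cases "s = t") auto
  have "G m h \<le> expectation (\<lambda>\<omega>. W \<omega> * rho (W \<omega> * (2 * m) + 0) + W \<omega> * rho (2 * h))"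
    unfolding G_def
  proof (intro integral_mono G_integrable Bochner_Integration.integrable_add integrable_mult_left W_integrable)
    fix \<omega> assume "\<omega> \<in> space M"
    then have W: "W \<omega> > 0" by (rule W_pos)
    have n: "W \<omega> * m \<ge> 0" using W assms by simp
    have "rho (W \<omega> * m + h) \<le> rho (2 * (W \<omega> * m)) + rho (2 * h)"
    proof (cases "W \<omega> * m \<le> h")
      case True
      then have "rho (W \<omega> * m + h) \<le> rho (2 * h)" using n assms by (intro mono) auto
      moreover have "rho (2 * (W \<omega> * m)) \<ge> 0" using mono[of 0 "2 * (W \<omega> * m)"] n by simp
      ultimately show ?thesis by simp
    next
      case False
      then have "rho (W \<omega> * m + h) \<le> rho (2 * (W \<omega> * m))"
        by (intro mono) (use n assms in linarith)+
      moreover have "rho (2 * h) \<ge> 0" using mono[of 0 "2 * h"] assms by simp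
      ultimately show ?thesis by simp
    qed
    then have "W \<omega> * rho (W \<omega> * m + h) \<le> W \<omega> * (rho (2 * (W \<omega> * m)) + rho (2 * h))"
      using W by (intro mult_left_mono) auto
    then show "W \<omega> * rho (W \<omega> * m + h) \<le> W \<omega> * rho (W \<omega> * (2 * m) + 0) + W \<omega> * rho (2 * h)"
      by (simp add: algebra_simps)
  qed
  also have "\<dots> = G (2 * m) 0 + EW * rho (2 * h)"
    using G_integrable[of "2 * m" 0] W_integrable by (simp add: G_def EW_def)
  finally show ?thesis .
qed

text \<open>Dropping h inside \<open>rho\<close> gives the upper bound. For the lower one,
  \<open>G_split\<close> isolates the effect of that h as \<open>EW * rho (2 * h)\<close>, of order
  h^5, hence eventually at most half of the linear right side.\<close>

lemma K_m_plus_critical: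
  "(\<lambda>h. m_plus M W (theta_c M W) h * K (m_plus M W (theta_c M W) h)) \<in> \<Theta>[at_right 0](\<lambda>h. h)"
proof -
  define v where "v = cumulant 2 0"
  have v: "v > 0" using cumulants_at_0 by (simp add: v_def)
  obtain A B where AB: "A > 0" "B > 0" "\<And>m. m > 0 \<Longrightarrow> A * (m * K m) \<le> G m 0"
     "\<And>m. m > 0 \<Longrightarrow> G m 0 \<le> B * (m * K m)" using G_bounds by blast
  obtain A' B' where AB': "A' > 0" "B' > 0"
    "\<And>t. t \<ge> 0 \<Longrightarrow> A' * min (t ^ 5) t \<le> rho t" "\<And>t. t \<ge> 0 \<Longrightarrow> rho t \<le> B' * min (t ^ 5) t"
    using rho_bounds by blast
  have ev: "\<forall>\<^sub>F h::real in at_right 0. 0 < h" by (auto simp: eventually_at_filter)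
  have "((\<lambda>h. B' * 32 * h ^ 4) \<longlongrightarrow> B' * 32 * 0 ^ 4) (at_right 0)"
    by (intro tendsto_intros)
  then have ev': "\<forall>\<^sub>F h in at_right 0. B' * 32 * h ^ 4 < v / 2"
    using v by (intro order_tendstoD) auto
  have "\<forall>\<^sub>F h in at_right 0. v * EW / (64 * B) * norm h \<le>
      norm (m_plus M W (theta_c M W) h * K (m_plus M W (theta_c M W) h)) \<and>
      norm (m_plus M W (theta_c M W) h * K (m_plus M W (theta_c M W) h)) \<le> v * EW / A * norm h"
    using m_plus_critical[OF zero_less_one] ev ev'
  proof eventually_elim
    case (elim h)
    define m where "m = m_plus M W (theta_c M W) h"
    have m: "m > 0" "G m h = v * EW * h" using elim by (simp_all add: m_def v_def)
    have mK: "m * K m > 0" using m K_pos[of m] by simp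
    have "A * (m * K m) \<le> G m 0" using AB m by simp
    also have "\<dots> \<le> v * EW * h" using G_mono[of m h] m elim by simp
    finally have 1: "m * K m \<le> v * EW / A * h" using AB by (simp add: field_simps)
    have "rho (2 * h) \<le> B' * (2 * h) ^ 5"
      using AB'(4)[of "2 * h"] AB'(2) elim(2)
        mult_left_mono[of "min ((2 * h) ^ 5) (2 * h)" "(2 * h) ^ 5" B'] by linarith
    also have "\<dots> = (B' * 32 * h ^ 4) * h" by (simp add: eval_nat_numeral)
    also have "\<dots> \<le> v / 2 * h" using elim by (intro mult_right_mono) auto
    finally have "EW * rho (2 * h) \<le> EW * (v / 2 * h)" using EW_pos by simp
    then have "v * EW * h / 2 \<le> G (2 * m) 0"
      using G_split[of m h] m elim by (simp add: field_simps)
    also have "\<dots> \<le> B * (2 * m * K (2 * m))" using AB(4)[of "2 * m"] m by simp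
    also have "\<dots> \<le> B * (2 * m * (16 * K m))"
      using AB m K_doubling by (intro mult_left_mono) auto
    \<comment> \<open>64 = 2 * 2 * 16, from the half that is kept, the doubled m and
      \<open>K_doubling\<close>.\<close>
    finally have 2: "v * EW / (64 * B) * h \<le> m * K m" using AB by (simp add: field_simps)
    show ?case unfolding m_def[symmetric] using 1 2 mK elim by (simp add: abs_of_pos)
  qed
  then show ?thesis
    using v EW_pos AB by (intro bigthetaI'[of "v * EW / (64 * B)" "v * EW / A"]) auto
qed

text \<open>The critical equation controls m K(m) instead of K(m), which raises the exponent by one:
  p = 4 gives 1/4 and 1/5, p = tau - 3 gives 1/(tau-3) and 1/(tau-2).\<close>

lemma asymptotics_powr:
  assumes K: "K \<in> \<Theta>[at_right 0](\<lambda>m. m powr p)" and p: "p > 0"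
  shows "(\<lambda>\<theta>. m_plus M W \<theta> 0) \<in> \<Theta>[at_right (theta_c M W)](\<lambda>\<theta>. (\<theta> - theta_c M W) powr (1 / p))"
    and "(\<lambda>h. m_plus M W (theta_c M W) h) \<in> \<Theta>[at_right 0](\<lambda>h. h powr (1 / (p + 1)))"
proof -
  have p1: "p + 1 > 0" using p by simp
  have "((\<lambda>m. m powr p) \<longlongrightarrow> 0) (at_right 0)" using p by real_asymp
  note K0 = K_tendsto_0[OF K this]
  note m = m_plus_zero_field_tendsto[OF K0]
  from landau_theta.compose[OF K m] K_m_plus_zero_field[OF K0]
  have "(\<lambda>\<theta>. m_plus M W \<theta> 0 powr p) \<in> \<Theta>[at_right (theta_c M W)](\<lambda>\<theta>. \<theta> - theta_c M W)"
    using landau_theta.trans bigtheta_sym by blast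
  then show "(\<lambda>\<theta>. m_plus M W \<theta> 0) \<in> \<Theta>[at_right (theta_c M W)](\<lambda>\<theta>. (\<theta> - theta_c M W) powr (1 / p))"
    by (rule bigtheta_inverse_powr[OF m p]) (auto simp: eventually_at_filter)
  have "(\<lambda>m. m * K m) \<in> \<Theta>[at_right 0](\<lambda>m. m * m powr p)"
    by (intro landau_theta.mult_left K)
  also have "(\<lambda>m. m * m powr p) \<in> \<Theta>[at_right 0](\<lambda>m. m powr (p + 1))"
    by (intro bigthetaI_cong) (auto simp: eventually_at_filter powr_add)
  finally have "(\<lambda>m. m * K m) \<in> \<Theta>[at_right 0](\<lambda>m. m powr (p + 1))" .
  from landau_theta.compose[OF this m_plus_critical_tendsto] K_m_plus_critical
  have "(\<lambda>h. m_plus M W (theta_c M W) h powr (p + 1)) \<in> \<Theta>[at_right 0](\<lambda>h. h)"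
    using landau_theta.trans bigtheta_sym by blast
  then show "(\<lambda>h. m_plus M W (theta_c M W) h) \<in> \<Theta>[at_right 0](\<lambda>h. h powr (1 / (p + 1)))"
    by (rule bigtheta_inverse_powr[OF m_plus_critical_tendsto p1]) (auto simp: eventually_at_filter)
qed

lemma asymptotics_powr_log:
  assumes K: "K \<in> \<Theta>[at_right 0](\<lambda>m. m powr p * ln (1 / m))" and p: "p > 0"
  shows "(\<lambda>\<theta>. m_plus M W \<theta> 0) \<in> \<Theta>[at_right (theta_c M W)](
      \<lambda>\<theta>. ((\<theta> - theta_c M W) / ln (1 / (\<theta> - theta_c M W))) powr (1 / p))"
    and "(\<lambda>h. m_plus M W (theta_c M W) h) \<in> \<Theta>[at_right 0](\<lambda>h. (h / ln (1 / h)) powr (1 / (p + 1)))"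
proof -
  have p1: "p + 1 > 0" using p by simp
  have "((\<lambda>m. m powr p * ln (1 / m)) \<longlongrightarrow> 0) (at_right 0)" using p by real_asymp
  note K0 = K_tendsto_0[OF K this]
  note m = m_plus_zero_field_tendsto[OF K0]
  from landau_theta.compose[OF K m] K_m_plus_zero_field[OF K0]
  have "(\<lambda>\<theta>. m_plus M W \<theta> 0 powr p * ln (1 / m_plus M W \<theta> 0)) \<in> \<Theta>[at_right (theta_c M W)](\<lambda>\<theta>. \<theta> - theta_c M W)"
    using landau_theta.trans bigtheta_sym by blast
  then show "(\<lambda>\<theta>. m_plus M W \<theta> 0) \<in> \<Theta>[at_right (theta_c M W)](
      \<lambda>\<theta>. ((\<theta> - theta_c M W) / ln (1 / (\<theta> - theta_c M W))) powr (1 / p))"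
    by (rule bigtheta_inverse_powr_log[OF m p]) (auto simp: eventually_at_filter)
  have "(\<lambda>m. m * K m) \<in> \<Theta>[at_right 0](\<lambda>m. m * (m powr p * ln (1 / m)))"
    by (intro landau_theta.mult_left K)
  also have "(\<lambda>m. m * (m powr p * ln (1 / m))) \<in> \<Theta>[at_right 0](\<lambda>m. m powr (p + 1) * ln (1 / m))"
    by (intro bigthetaI_cong) (auto simp: eventually_at_filter powr_add)
  finally have "(\<lambda>m. m * K m) \<in> \<Theta>[at_right 0](\<lambda>m. m powr (p + 1) * ln (1 / m))" .
  from landau_theta.compose[OF this m_plus_critical_tendsto] K_m_plus_critical
  have "(\<lambda>h. m_plus M W (theta_c M W) h powr (p + 1) * ln (1 / m_plus M W (theta_c M W) h)) \<in> \<Theta>[at_right 0](\<lambda>h. h)"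
    using landau_theta.trans bigtheta_sym by blast
  then show "(\<lambda>h. m_plus M W (theta_c M W) h) \<in> \<Theta>[at_right 0](\<lambda>h. (h / ln (1 / h)) powr (1 / (p + 1)))"
    by (rule bigtheta_inverse_powr_log[OF m_plus_critical_tendsto p1]) (auto simp: eventually_at_filter)
qed

end

theorem proposition5p9:
  "(\<forall>t>0. (deriv ^^ 3) log_mgf t < 0) \<and>
   ((deriv ^^ 6) log_mgf 0 < 0 \<and> (\<forall>k<6. \<not> (deriv ^^ k) log_mgf 0 < 0)) \<and>
   (\<forall>(M :: 'a measure) W.
      prob_space M \<and> W \<in> borel_measurable M \<and> (\<forall>\<omega>\<in>space M. W \<omega> > 0) \<and>
      integrable M (\<lambda>\<omega>. (W \<omega>)\<^sup>2) \<and>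
      (integrable M (\<lambda>\<omega>. (W \<omega>) ^ 6) \<or> (\<exists>\<tau>. 3 < \<tau> \<and> \<tau> \<le> 7 \<and> power_law M W \<tau>))
      \<longrightarrow>
      (integrable M (\<lambda>\<omega>. (W \<omega>) ^ 6) \<longrightarrow>
         (\<lambda>\<theta>. m_plus M W \<theta> 0) \<in> \<Theta>[at_right (theta_c M W)](\<lambda>\<theta>. (\<theta> - theta_c M W) powr (1/4)) \<and>
         (\<lambda>h. m_plus M W (theta_c M W) h) \<in> \<Theta>[at_right 0](\<lambda>h. h powr (1/5))) \<and>
      (\<forall>\<tau>. 3 < \<tau> \<and> \<tau> < 7 \<and> power_law M W \<tau> \<longrightarrow>
         (\<lambda>\<theta>. m_plus M W \<theta> 0) \<in> \<Theta>[at_right (theta_c M W)](\<lambda>\<theta>. (\<theta> - theta_c M W) powr (1 / (\<tau> - 3))) \<and>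
         (\<lambda>h. m_plus M W (theta_c M W) h) \<in> \<Theta>[at_right 0](\<lambda>h. h powr (1 / (\<tau> - 2)))) \<and>
      (power_law M W 7 \<longrightarrow>
         (\<lambda>\<theta>. m_plus M W \<theta> 0) \<in> \<Theta>[at_right (theta_c M W)](
            \<lambda>\<theta>. ((\<theta> - theta_c M W) / ln (1 / (\<theta> - theta_c M W))) powr (1/4)) \<and>
         (\<lambda>h. m_plus M W (theta_c M W) h) \<in> \<Theta>[at_right 0](\<lambda>h. (h / ln (1 / h)) powr (1/5))))"
proof (intro conjI allI impI)
  show "(deriv ^^ 3) log_mgf t < 0" if "t > 0" for t
    using cumulant3_neg[OF that] log_mgf_derivs[of 3] by simp
  show "(deriv ^^ 6) log_mgf 0 < 0"
    using cumulants_at_0 log_mgf_derivs[of 6] by simp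
  show "\<not> (deriv ^^ k) log_mgf 0 < 0" if "k < 6" for k
  proof -
    have "k \<in> {0, 1, 2, 3, 4, 5}" using that by auto
    then have "cumulant k 0 \<ge> 0" using cumulants_at_0 by (auto simp del: One_nat_def)
    then show ?thesis using log_mgf_derivs[of k] that by simp
  qed
next
  fix M :: "'a measure" and W
  assume *: "prob_space M \<and> W \<in> borel_measurable M \<and> (\<forall>\<omega>\<in>space M. W \<omega> > 0) \<and>
      integrable M (\<lambda>\<omega>. (W \<omega>)\<^sup>2) \<and>
      (integrable M (\<lambda>\<omega>. (W \<omega>) ^ 6) \<or> (\<exists>\<tau>. 3 < \<tau> \<and> \<tau> \<le> 7 \<and> power_law M W \<tau>))"
  then interpret weight M W
    by (intro weight.intro weight_axioms.intro) auto
  { assume "integrable M (\<lambda>\<omega>. (W \<omega>) ^ 6)"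
    note K_bigtheta_moment[OF this]
    from asymptotics_powr[OF this]
    show "(\<lambda>\<theta>. m_plus M W \<theta> 0) \<in> \<Theta>[at_right (theta_c M W)](\<lambda>\<theta>. (\<theta> - theta_c M W) powr (1/4))"
      "(\<lambda>h. m_plus M W (theta_c M W) h) \<in> \<Theta>[at_right 0](\<lambda>h. h powr (1/5))" by simp_all }
  { fix \<tau> assume "3 < \<tau> \<and> \<tau> < 7 \<and> power_law M W \<tau>"
    then have \<tau>: "power_law M W \<tau>" "3 < \<tau>" "\<tau> < 7" by auto
    from asymptotics_powr[OF K_bigtheta_power_law[OF \<tau>]] \<tau>
    show "(\<lambda>\<theta>. m_plus M W \<theta> 0) \<in> \<Theta>[at_right (theta_c M W)](\<lambda>\<theta>. (\<theta> - theta_c M W) powr (1 / (\<tau> - 3)))"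
      "(\<lambda>h. m_plus M W (theta_c M W) h) \<in> \<Theta>[at_right 0](\<lambda>h. h powr (1 / (\<tau> - 2)))" by simp_all }
  { assume "power_law M W 7"
    from asymptotics_powr_log[OF K_bigtheta_power_law_log[OF this]]
    show "(\<lambda>\<theta>. m_plus M W \<theta> 0) \<in> \<Theta>[at_right (theta_c M W)](
            \<lambda>\<theta>. ((\<theta> - theta_c M W) / ln (1 / (\<theta> - theta_c M W))) powr (1/4))"
      "(\<lambda>h. m_plus M W (theta_c M W) h) \<in> \<Theta>[at_right 0](\<lambda>h. (h / ln (1 / h)) powr (1/5))" by simp_all }
qed

end
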